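(* For the family of matrices $A=e^{-t(I-\mathbf{G})}$ (of size $n=|\mathrm{RM}(m,d)|$, with $k=n/2^{m/2}$, parameters as in the context, $m\to\infty$), the semidefinite program $$\max\ \mathrm{tr}(AX)\quad\text{s.t.}\quad\mathrm{tr}(X)=1,\ \mathbf{1}^{\intercal}|X|\mathbf{1}\le k,\ X\succcurlyeq0$$ has a feasible solution of value $\Omega(1)$, whereas every $k$-sparse rank-1 solution (equivalently, $x^{\intercal}Ax$ for every $x$ with $\|x\|_2=1$, $\|x\|_0\le k$) has value at most $1/\exp\exp(\Omega(\sqrt{\log\log n}))$.
   Context: $|X|$ is the entrywise absolute value. $\mathrm{RM}(m,d)$ is the Reed–Muller code of polynomials of total degree $\le d$ in $m$ variables over $\mathbb{F}_2$, viewed as functions $\mathbb{F}_2^m\to\mathbb{F}_2$. $T$ is the set of products of exactly $d$ linearly independent affine forms; $\mathbf{G}$ is the transition matrix of the Cayley graph on $\mathrm{RM}(m,d)$ with generating set $T$. Parameters: $\delta=2^{-m/2}$, $\eta=\delta^{1/(4\log_2 3)}$, $\varepsilon_2=\min\{\varepsilon_1,1/20\}$ with $\varepsilon_1>0$ the absolute constant from the Reed–Muller testing theorem of Bhattacharyya–Kopparty–Schoenebeck–Sudan–Zuckerman, $d=\log_2\log_2(1/\eta)+\log_2(1/\varepsilon_2)-1$ (assumed integer), $t=2^{d-1}$, $n=|\mathrm{RM}(m,d)|$, $k=n/2^{m/2}$. *)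

theory Defs
  imports Complex_Main "HOL-Library.FuncSet"
begin

text \<open>A point x of F_2^m is identified with its support {i<m. x_i = 1}.
  A function F_2^m -> F_2 is an extensional function on Pts m with values in bool
  (True = 1).\<close>

definition Pts :: "nat \<Rightarrow> nat set set" where
  "Pts m = Pow {..<m}"

definition xorset :: "nat set \<Rightarrow> nat set \<Rightarrow> nat set" where
  "xorset A B = (A - B) \<union> (B - A)"

definition vsum :: "'i set \<Rightarrow> ('i \<Rightarrow> nat set) \<Rightarrow> nat set" where
  "vsum J v = {j. odd (card {i\<in>J. j \<in> v i})}"

definition fadd :: "nat \<Rightarrow> (nat set \<Rightarrow> bool) \<Rightarrow> (nat set \<Rightarrow> bool) \<Rightarrow> (nat set \<Rightarrow> bool)" where
  "fadd m f g = (\<lambda>x\<in>Pts m. f x \<noteq> g x)"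

text \<open>A multilinear polynomial over F_2 is a set C of monomials (sets S of variables);
  its value at x is the parity of the number of monomials S in C with all x_i = 1, i in S.
  Every polynomial function F_2^m -> F_2 of degree <= d is of this form.\<close>
definition RM :: "nat \<Rightarrow> nat \<Rightarrow> (nat set \<Rightarrow> bool) set" where
  "RM m d = {(\<lambda>x\<in>Pts m. odd (card {S\<in>C. S \<subseteq> x})) | C.
              C \<subseteq> {S. S \<subseteq> {..<m} \<and> card S \<le> d}}"

definition aff :: "nat set \<Rightarrow> bool \<Rightarrow> nat set \<Rightarrow> bool" where
  "aff a b x = (odd (card (a \<inter> x)) \<noteq> b)"

definition lin_indep :: "nat \<Rightarrow> (nat \<Rightarrow> nat set) \<Rightarrow> bool" where
  "lin_indep d a = (\<forall>J. J \<subseteq> {..<d} \<longrightarrow> J \<noteq> {} \<longrightarrow> vsum J a \<noteq> {})"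

definition Tgen :: "nat \<Rightarrow> nat \<Rightarrow> (nat set \<Rightarrow> bool) set" where
  "Tgen m d = {(\<lambda>x\<in>Pts m. \<forall>i<d. aff (a i) (b i) x) | a b.
                 (\<forall>i<d. a i \<subseteq> {..<m}) \<and> lin_indep d a}"

text \<open>Transition matrix of the Cayley graph on RM(m,d) with generating set T.\<close>
definition Gmat :: "nat \<Rightarrow> nat \<Rightarrow> (nat set \<Rightarrow> bool) \<Rightarrow> (nat set \<Rightarrow> bool) \<Rightarrow> real" where
  "Gmat m d f g = real (card {h \<in> Tgen m d. fadd m f h = g}) / real (card (Tgen m d))"

definition mmul :: "'a set \<Rightarrow> ('a \<Rightarrow> 'a \<Rightarrow> real) \<Rightarrow> ('a \<Rightarrow> 'a \<Rightarrow> real) \<Rightarrow> 'a \<Rightarrow> 'a \<Rightarrow> real" where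
  "mmul V M N = (\<lambda>i j. \<Sum>l\<in>V. M i l * N l j)"

fun mpow :: "'a set \<Rightarrow> ('a \<Rightarrow> 'a \<Rightarrow> real) \<Rightarrow> nat \<Rightarrow> 'a \<Rightarrow> 'a \<Rightarrow> real" where
  "mpow V M 0 = (\<lambda>i j. if i = j then 1 else 0)"
| "mpow V M (Suc p) = mmul V (mpow V M p) M"

definition mexp :: "'a set \<Rightarrow> ('a \<Rightarrow> 'a \<Rightarrow> real) \<Rightarrow> 'a \<Rightarrow> 'a \<Rightarrow> real" where
  "mexp V M = (\<lambda>i j. \<Sum>p. mpow V M p i j / fact p)"

definition mtrace :: "'a set \<Rightarrow> ('a \<Rightarrow> 'a \<Rightarrow> real) \<Rightarrow> real" where
  "mtrace V M = (\<Sum>i\<in>V. M i i)"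

definition psd :: "'a set \<Rightarrow> ('a \<Rightarrow> 'a \<Rightarrow> real) \<Rightarrow> bool" where
  "psd V X = ((\<forall>i\<in>V. \<forall>j\<in>V. X i j = X j i) \<and>
              (\<forall>x. (\<Sum>i\<in>V. \<Sum>j\<in>V. x i * X i j * x j) \<ge> 0))"

definition Amat :: "nat \<Rightarrow> nat \<Rightarrow> real \<Rightarrow> (nat set \<Rightarrow> bool) \<Rightarrow> (nat set \<Rightarrow> bool) \<Rightarrow> real" where
  "Amat m d t = mexp (RM m d)
     (\<lambda>f g. - t * ((if f = g then 1 else 0) - Gmat m d f g))"

definition rm_dist :: "nat \<Rightarrow> nat \<Rightarrow> (nat set \<Rightarrow> bool) \<Rightarrow> real" where
  "rm_dist m d f = Min {real (card {x\<in>Pts m. f x \<noteq> g x}) / 2 ^ m | g. g \<in> RM m d}"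

text \<open>Rejection probability of the (d+1)-test: choose a, v_0..v_d uniformly in F_2^m and
  reject iff the sum over S \<subseteq> {0..d} of f(a + sum_{i in S} v_i) is 1.\<close>
definition rm_rej :: "nat \<Rightarrow> nat \<Rightarrow> (nat set \<Rightarrow> bool) \<Rightarrow> real" where
  "rm_rej m d f =
     real (card {(a, v). a \<in> Pts m \<and> v \<in> Pi\<^sub>E {..d} (\<lambda>_. Pts m) \<and>
                   odd (card {S \<in> Pow {..d}. f (xorset a (vsum S v))})})
     / (2 ^ m * 2 ^ (m * (d + 1)))"

text \<open>eps is a valid constant for the Reed--Muller testing theorem of
  Bhattacharyya--Kopparty--Schoenebeck--Sudan--Zuckerman.\<close>
definition bkssz_const :: "real \<Rightarrow> bool" where
  "bkssz_const eps = (eps > 0 \<and>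
     (\<forall>m d f. f \<in> extensional (Pts m) \<longrightarrow>
        rm_rej m d f \<ge> min (2 ^ d * rm_dist m d f) eps))"

definition eps2 :: "real \<Rightarrow> real" where
  "eps2 eps1 = min eps1 (1/20)"

definition deltap :: "nat \<Rightarrow> real" where
  "deltap m = 2 powr (- real m / 2)"

definition etap :: "nat \<Rightarrow> real" where
  "etap m = deltap m powr (1 / (4 * log 2 3))"

definition dpar :: "real \<Rightarrow> nat \<Rightarrow> real" where
  "dpar eps1 m = log 2 (log 2 (1 / etap m)) + log 2 (1 / eps2 eps1) - 1"

end

theory Submission
  imports Defs "HOL-Analysis.Convex" "HOL-Analysis.Harmonic_Numbers"
begin

text \<open>
  Both bounds come from the characters chi A, f \<mapsto> (-1)^|{x in A. f x}|, for A a set of points of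
  F_2^m. They diagonalise G, the eigenvalue at A being 1 - 2 Pr_h[<A, h> = 1] for a random
  generator h. A point p lies on a random generator with probability 2^-d, so the 2^m dictators
  chi {p} have eigenvalue exp (-1) under exp (-t (I - G)); the normalised projection onto their
  span solves the semidefinite program, and its entrywise 1-norm is bounded by Cauchy-Schwarz from
  pairwise independence of the code.

  For a sparse unit vector x, split its Fourier weight at distance l = m/16 from the dual code
  RM(m, m-d-1). Near the dual code, Bonami's fourth-moment bound applies because l is below a
  quarter of the dual distance 2^(d+1), and sparsity makes that weight at most 3^l 2^(-m/4). Far
  from it, the testing theorem makes the eigenvalue exponentially small in m. The value is thus
  at most exp (-m/64), whereas sqrt (ln (ln n)) = O (ln m), so there is ample room.

  Sums run over all A rather than over representatives modulo the dual code: the characters are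
  then linearly dependent on the code but still form a tight frame, and no duality theory is needed.
\<close>

section \<open>Characters and the fourth-moment bound\<close>

text \<open>Why the testing theorem speaks about eigenvalues: the support of a generator is an
  affine subspace of dimension m-d, and the test for degree m-d-1 adds up values over a base point
  plus the span of m-d random directions. Conditioned on independent directions, its rejection
  probability is Pr_h[<A, h> = 1]. The scale t = 2^(d-1) gives 2 t 2^(-d) = 1, so dictators keep a
  constant eigenvalue. A set at distance more than l from the dual code is rejected with probability
  at least min (l 2^(-d-1), eps), so its exponent is at most -min (l/2, eps 2^d). The cutoff l is
  squeezed from both sides: 4 l must stay below 2^(d+1) and 3^l well below 2^(m/4), yet l must be
  linear in m for the far part to decay. The choice of d leaves room: 2^d = m / (16 eps2 log_2 3) is
  linear in m, and eps2 <= 1/20 gives 2^(d+1) >= m. At l = m/16 the near part is at most 2^(-m/8)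
  and the far part about exp (-m/32).\<close>

definition chi :: "'a set \<Rightarrow> ('a \<Rightarrow> bool) \<Rightarrow> real" where
  "chi A f = (\<Prod>x\<in>A. if f x then -1 else 1)"

lemma chi_empty [simp]: "chi {} f = 1"
  by (simp add: chi_def)

lemma chi_insert: "finite A \<Longrightarrow> x \<notin> A \<Longrightarrow> chi (insert x A) f = (if f x then -1 else 1) * chi A f"
  by (simp add: chi_def)

lemma chi_singleton [simp]: "chi {x} f = (if f x then -1 else 1)"
  by (simp add: chi_def)

lemma chi_cong: "(\<And>x. x \<in> A \<Longrightarrow> f x = g x) \<Longrightarrow> chi A f = chi A g"
  unfolding chi_def by (rule prod.cong) auto

lemma chi_mult_self [simp]: "chi A f * chi A f = 1"
  unfolding chi_def prod.distrib[symmetric] by (rule prod.neutral) auto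

lemma chi_neq: "chi A (\<lambda>x. f x \<noteq> g x) = chi A f * chi A g"
  unfolding chi_def prod.distrib[symmetric] by (rule prod.cong) auto

lemma chi_parity: "finite A \<Longrightarrow> chi A f = (if odd (card {x\<in>A. f x}) then -1 else 1)"
proof (induction A rule: finite_induct)
  case (insert x A)
  have "{y \<in> insert x A. f y} = (if f x then insert x {y\<in>A. f y} else {y\<in>A. f y})"
    by auto
  then show ?case using insert by (auto simp: chi_insert)
qed simp

lemma chi_sym_diff:
  assumes "finite A" "finite B"
  shows "chi (sym_diff A B) f = chi A f * chi B f"
proof -
  have un: "chi (X \<union> Y) f = chi X f * chi Y f" if "finite X" "finite Y" "X \<inter> Y = {}" for X Y
    using that unfolding chi_def by (rule prod.union_disjoint)
  have "(A - B) \<union> (A \<inter> B) = A" "(B - A) \<union> (A \<inter> B) = B" by auto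
  then have "chi A f = chi (A - B) f * chi (A \<inter> B) f" "chi B f = chi (B - A) f * chi (A \<inter> B) f"
    using un[of "A - B" "A \<inter> B"] un[of "B - A" "A \<inter> B"] assms by (auto simp: disjoint_iff)
  moreover have "chi (sym_diff A B) f = chi (A - B) f * chi (B - A) f"
    using assms by (intro un) auto
  ultimately show ?thesis
    using chi_mult_self[of "A \<inter> B" f] by (simp add: mult.assoc mult.left_commute)
qed

text \<open>Both sides are the sign of |A \<inter> B|, so point and frequency can be exchanged. Thus
  \<open>chi\<close> serves as a character of the code, applied to a codeword, and of the cube,
  applied to a membership predicate.\<close>

lemma chi_commute:
  assumes "finite A" "finite B"
  shows "chi A (\<lambda>x. x \<in> B) = chi B (\<lambda>x. x \<in> A)"
proof -
  have "{x\<in>A. x \<in> B} = {x\<in>B. x \<in> A}" by auto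
  then show ?thesis using assms by (simp add: chi_parity)
qed

section \<open>Orthogonality and hypercontractivity on the cube\<close>

lemma sum_Pow_insert:
  fixes F :: "'a set \<Rightarrow> 'b::comm_monoid_add"
  assumes "finite U" "u \<notin> U"
  shows "(\<Sum>Z\<in>Pow (insert u U). F Z) = (\<Sum>Z\<in>Pow U. F Z + F (insert u Z))"
proof -
  have "(\<Sum>Z\<in>Pow (insert u U). F Z) = sum F (Pow U) + sum F (insert u ` Pow U)"
    unfolding Pow_insert using assms by (intro sum.union_disjoint) auto
  also have "sum F (insert u ` Pow U) = (\<Sum>Z\<in>Pow U. F (insert u Z))"
    using assms by (subst sum.reindex) (auto intro!: inj_onI simp: insert_ident dest!: subsetD)
  finally show ?thesis by (simp add: sum.distrib)
qed

lemma sum_Pow_prod: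
  fixes s :: "'a \<Rightarrow> 'b::comm_semiring_1"
  assumes "finite U"
  shows "(\<Sum>A\<in>Pow U. \<Prod>x\<in>A. s x) = (\<Prod>x\<in>U. 1 + s x)"
  using prod_add[OF assms, of s "\<lambda>_. 1"] by (simp add: add.commute)

text \<open>The sum factorises over U, and a point where f holds contributes the factor 1 -
  1.\<close>

lemma sum_Pow_chi:
  assumes "finite U"
  shows "(\<Sum>A\<in>Pow U. chi A f) = (if \<exists>x\<in>U. f x then 0 else 2 ^ card U)"
proof -
  have "(\<Sum>A\<in>Pow U. chi A f) = (\<Prod>x\<in>U. 1 + (if f x then -1 else 1))"
    unfolding chi_def using assms by (rule sum_Pow_prod)
  also have "\<dots> = (if \<exists>x\<in>U. f x then 0 else 2 ^ card U)"
    using assms by (auto simp: prod_zero_iff)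
  finally show ?thesis .
qed

lemma sum_Pow_chi_mem:
  assumes "finite U" "A \<subseteq> U"
  shows "(\<Sum>Z\<in>Pow U. chi A (\<lambda>x. x \<in> Z)) = (if A = {} then 2 ^ card U else 0)"
proof -
  have "(\<Sum>Z\<in>Pow U. chi A (\<lambda>x. x \<in> Z)) = (\<Sum>Z\<in>Pow U. chi Z (\<lambda>x. x \<in> A))"
    using assms by (intro sum.cong refl chi_commute) (auto intro: finite_subset)
  then show ?thesis using assms by (auto simp: sum_Pow_chi)
qed

text \<open>Hypercontractivity by induction on the coordinates. Splitting off u turns the polynomial
  into h + g or h - g, where g has degree one less. Odd powers cancel, Cauchy-Schwarz treats the
  mixed term, and the factor 9 saved by g pays for it. Both c and l are generalised, since g has its
  own coefficients and degree.\<close>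

lemma bonami:
  fixes c :: "'a set \<Rightarrow> real"
  assumes "finite U" "\<And>B. B \<subseteq> U \<Longrightarrow> l < card B \<Longrightarrow> c B = 0"
  shows "(\<Sum>Z\<in>Pow U. (\<Sum>B\<in>Pow U. c B * chi B (\<lambda>x. x \<in> Z)) ^ 4)
    \<le> 2 ^ card U * (9 ^ l * (\<Sum>B\<in>Pow U. (c B)\<^sup>2)\<^sup>2)"
  using assms
proof (induction U arbitrary: c l rule: finite_induct)
  case empty
  have "1 * ((c {})\<^sup>2)\<^sup>2 \<le> 9 ^ l * ((c {})\<^sup>2)\<^sup>2"
    by (rule mult_right_mono) auto
  then show ?case by (simp flip: power_mult)
next
  case (insert u U)
  define h where "h = (\<lambda>Z. \<Sum>B\<in>Pow U. c B * chi B (\<lambda>x. x \<in> Z))"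
  define g where "g = (\<lambda>Z. \<Sum>B\<in>Pow U. c (insert u B) * chi B (\<lambda>x. x \<in> Z))"
  define H where "H = (\<Sum>B\<in>Pow U. (c B)\<^sup>2)"
  define G where "G = (\<Sum>B\<in>Pow U. (c (insert u B))\<^sup>2)"
  define P where "P = (2::real) ^ card U"
  have nonneg: "H \<ge> 0" "G \<ge> 0" "P \<ge> 0"
    unfolding H_def G_def P_def by (auto intro: sum_nonneg)
  have memU: "finite B \<and> u \<notin> B" if "B \<in> Pow U" for B
    using that insert finite_subset by auto
  have c0: "c B = 0" if "B \<subseteq> U" "l < card B" for B
    using that insert.prems by auto
  have low: "(\<Sum>B\<in>Pow (insert u U). c B * chi B (\<lambda>x. x \<in> Z)) = h Z + g Z"
    and high: "(\<Sum>B\<in>Pow (insert u U). c B * chi B (\<lambda>x. x \<in> insert u Z)) = h Z - g Z"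
    if Z: "Z \<in> Pow U" for Z
  proof -
    have eq: "chi B (\<lambda>x. x = u \<or> x \<in> Z) = chi B (\<lambda>x. x \<in> Z)" if "B \<in> Pow U" for B
      using memU[OF that] by (intro chi_cong) auto
    show "(\<Sum>B\<in>Pow (insert u U). c B * chi B (\<lambda>x. x \<in> Z)) = h Z + g Z"
      using insert(1,2) memU Z unfolding h_def g_def
      by (subst sum_Pow_insert) (auto simp: chi_insert sum.distrib[symmetric] intro!: sum.cong)
    show "(\<Sum>B\<in>Pow (insert u U). c B * chi B (\<lambda>x. x \<in> insert u Z)) = h Z - g Z"
      using insert(1,2) memU eq unfolding h_def g_def
      by (subst sum_Pow_insert) (auto simp: chi_insert sum_subtractf[symmetric] intro!: sum.cong)
  qed
  have "(\<Sum>Z\<in>Pow (insert u U). (\<Sum>B\<in>Pow (insert u U). c B * chi B (\<lambda>x. x \<in> Z)) ^ 4)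
      = (\<Sum>Z\<in>Pow U. (h Z + g Z) ^ 4 + (h Z - g Z) ^ 4)"
    using insert(1,2) low high by (subst sum_Pow_insert) (auto intro!: sum.cong)
  also have "\<dots> = (\<Sum>Z\<in>Pow U. 2 * h Z ^ 4 + 12 * ((h Z)\<^sup>2 * (g Z)\<^sup>2) + 2 * g Z ^ 4)"
    by (rule sum.cong[OF refl]) (simp add: eval_nat_numeral algebra_simps)
  also have "\<dots> = 2 * (\<Sum>Z\<in>Pow U. h Z ^ 4) + 12 * (\<Sum>Z\<in>Pow U. (h Z)\<^sup>2 * (g Z)\<^sup>2) + 2 * (\<Sum>Z\<in>Pow U. g Z ^ 4)"
    by (simp add: sum.distrib sum_distrib_left)
  also have "\<dots> \<le> 2 * P * (9 ^ l * (H + G)\<^sup>2)"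
  proof (cases l)
    \<comment> \<open>At level 0 there is no degree to take away from g, but then g
      vanishes.\<close>
    case 0
    have z: "c (insert u B) = 0" if "B \<in> Pow U" for B
      using insert.prems[of "insert u B"] memU[OF that] that 0 by auto
    have "(\<Sum>Z\<in>Pow U. h Z ^ 4) \<le> P * (9 ^ l * H\<^sup>2)"
      unfolding h_def H_def P_def using c0 by (rule insert.IH)
    moreover have "g Z = 0" for Z unfolding g_def using z by (intro sum.neutral) auto
    moreover have "G = 0" unfolding G_def using z by (intro sum.neutral) auto
    ultimately show ?thesis by simp
  next
    case (Suc l')
    define Q where "Q = P * 9 ^ l'"
    have Q: "Q \<ge> 0" unfolding Q_def using nonneg by simp
    have h4: "(\<Sum>Z\<in>Pow U. h Z ^ 4) \<le> Q * 9 * H\<^sup>2"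
      using insert.IH[of l c, OF c0] Suc unfolding h_def H_def P_def Q_def by (simp add: mult_ac)
    have "(\<Sum>Z\<in>Pow U. g Z ^ 4) \<le> P * (9 ^ l' * G\<^sup>2)"
      unfolding g_def G_def P_def
    proof (rule insert.IH)
      fix B assume "B \<subseteq> U" "l' < card B"
      then show "c (insert u B) = 0"
        using insert.prems[of "insert u B"] memU[of B] Suc by auto
    qed
    then have g4: "(\<Sum>Z\<in>Pow U. g Z ^ 4) \<le> Q * G\<^sup>2" by (simp add: Q_def mult_ac)
    have "(\<Sum>Z\<in>Pow U. (h Z)\<^sup>2 * (g Z)\<^sup>2)\<^sup>2 \<le> (\<Sum>Z\<in>Pow U. ((h Z)\<^sup>2)\<^sup>2) * (\<Sum>Z\<in>Pow U. ((g Z)\<^sup>2)\<^sup>2)"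
      by (rule Cauchy_Schwarz_ineq_sum)
    also have "\<dots> \<le> (Q * 9 * H\<^sup>2) * (Q * G\<^sup>2)"
      using h4 g4 Q nonneg by (intro mult_mono sum_nonneg) (auto simp flip: power_mult)
    also have "\<dots> = (3 * Q * H * G)\<^sup>2" by (simp add: power2_eq_square)
    finally have "(\<Sum>Z\<in>Pow U. (h Z)\<^sup>2 * (g Z)\<^sup>2) \<le> 3 * Q * H * G"
      by (rule power2_le_imp_le) (use Q nonneg in auto)
    with h4 g4 have "2 * (\<Sum>Z\<in>Pow U. h Z ^ 4) + 12 * (\<Sum>Z\<in>Pow U. (h Z)\<^sup>2 * (g Z)\<^sup>2) + 2 * (\<Sum>Z\<in>Pow U. g Z ^ 4)
       \<le> 2 * (Q * 9 * H\<^sup>2) + 12 * (3 * Q * H * G) + 2 * (Q * G\<^sup>2)" by linarith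
    \<comment> \<open>Up to Q the left side is 18 H^2 + 36 H G + 2 G^2: with 9 per level the cross
      terms match exactly.\<close>
    also have "\<dots> \<le> 18 * Q * (H + G)\<^sup>2"
      using Q nonneg by (simp add: power2_eq_square algebra_simps)
    finally show ?thesis by (simp add: Q_def Suc mult_ac)
  qed
  also have "\<dots> = 2 ^ card (insert u U) * (9 ^ l * (\<Sum>B\<in>Pow (insert u U). (c B)\<^sup>2)\<^sup>2)"
  proof -
    have "(\<Sum>B\<in>Pow (insert u U). (c B)\<^sup>2) = H + G"
      unfolding H_def G_def using insert(1,2) by (subst sum_Pow_insert) (auto simp: sum.distrib)
    then show ?thesis using insert(1,2) by (simp add: P_def)
  qed
  finally show ?case .
qed

text \<open>A product of four characters is again a character, so a fourth moment depends on the
  sample only through its character sums. The family \<open>e\<close> is arbitrary so that the same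
  expansion serves the code and the full cube.\<close>

lemma sum_fourth_power:
  fixes c :: "'a set \<Rightarrow> real"
  assumes fin: "finite W" "\<And>B. B \<in> W \<Longrightarrow> finite B"
  shows "(\<Sum>i\<in>I. (\<Sum>B\<in>W. c B * chi B (e i)) ^ 4) =
    (\<Sum>B1\<in>W. \<Sum>B2\<in>W. \<Sum>B3\<in>W. \<Sum>B4\<in>W. c B1 * c B2 * c B3 * c B4 *
      (\<Sum>i\<in>I. chi (sym_diff (sym_diff B1 B2) (sym_diff B3 B4)) (e i)))"
proof -
  have "(\<Sum>B\<in>W. c B * chi B (e i)) ^ 4 =
     (\<Sum>B1\<in>W. \<Sum>B2\<in>W. \<Sum>B3\<in>W. \<Sum>B4\<in>W. c B1 * c B2 * c B3 * c B4 *
      chi (sym_diff (sym_diff B1 B2) (sym_diff B3 B4)) (e i))" for i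
  proof -
    have chi4: "chi (sym_diff (sym_diff B1 B2) (sym_diff B3 B4)) (e i)
       = chi B1 (e i) * chi B2 (e i) * (chi B3 (e i) * chi B4 (e i))"
      if "B1 \<in> W" "B2 \<in> W" "B3 \<in> W" "B4 \<in> W" for B1 B2 B3 B4
      using that fin(2) by (subst chi_sym_diff; simp add: chi_sym_diff)
    have "(\<Sum>B\<in>W. c B * chi B (e i)) ^ 4 = ((\<Sum>B\<in>W. c B * chi B (e i)) * (\<Sum>B\<in>W. c B * chi B (e i)))
        * ((\<Sum>B\<in>W. c B * chi B (e i)) * (\<Sum>B\<in>W. c B * chi B (e i)))"
      by (simp add: eval_nat_numeral)
    also have "\<dots> = (\<Sum>B1\<in>W. \<Sum>B2\<in>W. \<Sum>B3\<in>W. \<Sum>B4\<in>W. (c B1 * chi B1 (e i)) * (c B2 * chi B2 (e i))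
        * ((c B3 * chi B3 (e i)) * (c B4 * chi B4 (e i))))"
      by (simp only: sum_distrib_left sum_distrib_right sum_product) (simp only: mult_ac)
    finally show ?thesis using chi4 by (auto intro!: sum.cong simp: mult_ac)
  qed
  then have "(\<Sum>i\<in>I. (\<Sum>B\<in>W. c B * chi B (e i)) ^ 4) = (\<Sum>i\<in>I. (\<Sum>B1\<in>W. \<Sum>B2\<in>W. \<Sum>B3\<in>W. \<Sum>B4\<in>W.
      c B1 * c B2 * c B3 * c B4 * chi (sym_diff (sym_diff B1 B2) (sym_diff B3 B4)) (e i)))"
    by simp
  also have "\<dots> = (\<Sum>B1\<in>W. \<Sum>B2\<in>W. \<Sum>B3\<in>W. \<Sum>B4\<in>W. \<Sum>i\<in>I.
      c B1 * c B2 * c B3 * c B4 * chi (sym_diff (sym_diff B1 B2) (sym_diff B3 B4)) (e i))"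
    by (simp only: sum.swap[of _ _ I])
  finally show ?thesis by (simp add: sum_distrib_left)
qed

lemma card_sym_diff_le: "finite A \<Longrightarrow> finite B \<Longrightarrow> card (sym_diff A B) \<le> card A + card B"
  by (meson Diff_subset add_mono card_Un_le card_mono dual_order.trans)

text \<open>Every frequency in the expansion has at most 4 l points, and on those the code cannot be
  told from the cube. So the fourth moment over the code equals the one over the cube, where
  \<open>bonami\<close> applies.\<close>

lemma fourth_moment_code:
  fixes c :: "'a set \<Rightarrow> real" and V :: "('a \<Rightarrow> bool) set"
  assumes U: "finite U"
    and dual: "\<And>B. B \<subseteq> U \<Longrightarrow> B \<noteq> {} \<Longrightarrow> card B \<le> 4 * l \<Longrightarrow> (\<Sum>f\<in>V. chi B f) = 0"
  defines "W \<equiv> {B. B \<subseteq> U \<and> card B \<le> l}"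
  shows "(\<Sum>f\<in>V. (\<Sum>B\<in>W. c B * chi B f) ^ 4) \<le> card V * (9 ^ l * (\<Sum>B\<in>W. (c B)\<^sup>2)\<^sup>2)"
proof -
  have W: "finite W" "\<And>B. B \<in> W \<Longrightarrow> finite B"
    using U finite_subset unfolding W_def by auto
  let ?D = "\<lambda>B1 B2 B3 B4. sym_diff (sym_diff B1 B2) (sym_diff B3 B4)"
  \<comment> \<open>Equality of the two averages, multiplied out: both are 1 at the empty frequency
    and 0 elsewhere.\<close>
  have D: "(\<Sum>f\<in>V. chi (?D B1 B2 B3 B4) f) * 2 ^ card U
      = card V * (\<Sum>Z\<in>Pow U. chi (?D B1 B2 B3 B4) (\<lambda>x. x \<in> Z))"
    if B: "B1 \<in> W" "B2 \<in> W" "B3 \<in> W" "B4 \<in> W" for B1 B2 B3 B4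
  proof -
    have "card (sym_diff B1 B2) \<le> 2 * l" "card (sym_diff B3 B4) \<le> 2 * l"
      using card_sym_diff_le[OF W(2)[OF B(1)] W(2)[OF B(2)]]
        card_sym_diff_le[OF W(2)[OF B(3)] W(2)[OF B(4)]] B
      by (auto simp: W_def)
    then have card: "card (?D B1 B2 B3 B4) \<le> 4 * l"
      using card_sym_diff_le[of "sym_diff B1 B2" "sym_diff B3 B4"] W(2) B by simp
    have sub: "?D B1 B2 B3 B4 \<subseteq> U" using B unfolding W_def by blast
    show ?thesis
      unfolding sum_Pow_chi_mem[OF U sub] using dual[OF sub _ card]
      by (cases "?D B1 B2 B3 B4 = {}") (simp_all only: chi_empty, auto)
  qed
  have eq: "(\<Sum>f\<in>V. (\<Sum>B\<in>W. c B * chi B f) ^ 4) * 2 ^ card U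
     = card V * (\<Sum>Z\<in>Pow U. (\<Sum>B\<in>W. c B * chi B (\<lambda>x. x \<in> Z)) ^ 4)"
  proof -
    have "(\<Sum>f\<in>V. (\<Sum>B\<in>W. c B * chi B f) ^ 4) * 2 ^ card U =
      (\<Sum>B1\<in>W. \<Sum>B2\<in>W. \<Sum>B3\<in>W. \<Sum>B4\<in>W. c B1 * c B2 * c B3 * c B4 *
        ((\<Sum>f\<in>V. chi (?D B1 B2 B3 B4) f) * 2 ^ card U))"
      by (simp only: sum_fourth_power[OF W] sum_distrib_right mult.assoc)
    also have "\<dots> = (\<Sum>B1\<in>W. \<Sum>B2\<in>W. \<Sum>B3\<in>W. \<Sum>B4\<in>W. c B1 * c B2 * c B3 * c B4 *
        (card V * (\<Sum>Z\<in>Pow U. chi (?D B1 B2 B3 B4) (\<lambda>x. x \<in> Z))))"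
      by (intro sum.cong refl) (simp only: D)
    also have "\<dots> = card V * (\<Sum>Z\<in>Pow U. (\<Sum>B\<in>W. c B * chi B (\<lambda>x. x \<in> Z)) ^ 4)"
      by (simp only: sum_fourth_power[OF W] sum_distrib_left mult_ac)
    finally show ?thesis .
  qed
  \<comment> \<open>\<open>bonami\<close> sums over all frequencies, so c is extended by zero above
    level l.\<close>
  have "(\<Sum>Z\<in>Pow U. (\<Sum>B\<in>W. c B * chi B (\<lambda>x. x \<in> Z)) ^ 4)
     = (\<Sum>Z\<in>Pow U. (\<Sum>B\<in>Pow U. (if card B \<le> l then c B else 0) * chi B (\<lambda>x. x \<in> Z)) ^ 4)"
    using U by (intro sum.cong refl arg_cong[where f="\<lambda>x. x ^ 4"] sum.mono_neutral_cong_left)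
      (auto simp: W_def)
  also have "\<dots> \<le> 2 ^ card U * (9 ^ l * (\<Sum>B\<in>Pow U. (if card B \<le> l then c B else 0)\<^sup>2)\<^sup>2)"
    by (rule bonami[OF U]) simp
  also have "(\<Sum>B\<in>Pow U. (if card B \<le> l then c B else 0)\<^sup>2) = (\<Sum>B\<in>W. (c B)\<^sup>2)"
    using U by (intro sum.mono_neutral_cong_right) (auto simp: W_def)
  finally have "card V * (\<Sum>Z\<in>Pow U. (\<Sum>B\<in>W. c B * chi B (\<lambda>x. x \<in> Z)) ^ 4)
      \<le> card V * (2 ^ card U * (9 ^ l * (\<Sum>B\<in>W. (c B)\<^sup>2)\<^sup>2))"
    by (rule mult_left_mono) simp
  then show ?thesis
    unfolding eq[symmetric] by (simp add: mult.left_commute[of _ "2 ^ card U"] mult.commute[of _ "2 ^ card U"])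
qed

text \<open>The low-level weight L is the inner product of x with its low-level part y.
  Cauchy-Schwarz on the support of x, applied twice, bounds L^4 by the support size times the fourth
  moment of y, which is itself at most |V| 9^l L^2. Cancelling L^2 gives the claim.\<close>

lemma low_level_weight:
  fixes x :: "('a \<Rightarrow> bool) \<Rightarrow> real"
  assumes U: "finite U" and V: "finite V"
    and dual: "\<And>B. B \<subseteq> U \<Longrightarrow> B \<noteq> {} \<Longrightarrow> card B \<le> 4 * l \<Longrightarrow> (\<Sum>f\<in>V. chi B f) = 0"
    and unit: "(\<Sum>f\<in>V. (x f)\<^sup>2) = 1"
  shows "(\<Sum>B | B \<subseteq> U \<and> card B \<le> l. (\<Sum>f\<in>V. x f * chi B f)\<^sup>2)\<^sup>2
    \<le> real (card {f\<in>V. x f \<noteq> 0}) * real (card V) * 9 ^ l"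
proof -
  define W where "W = {B. B \<subseteq> U \<and> card B \<le> l}"
  define c where "c = (\<lambda>B. \<Sum>f\<in>V. x f * chi B f)"
  define y where "y = (\<lambda>f. \<Sum>B\<in>W. c B * chi B f)"
  define L where "L = (\<Sum>B\<in>W. (c B)\<^sup>2)"
  define S where "S = {f\<in>V. x f \<noteq> 0}"
  have S: "finite S" unfolding S_def using V by auto
  have L0: "L \<ge> 0" unfolding L_def by (simp add: sum_nonneg)
  have "L = (\<Sum>B\<in>W. \<Sum>f\<in>V. c B * (x f * chi B f))"
    unfolding L_def by (simp add: power2_eq_square sum_distrib_left[symmetric] c_def)
  also have "\<dots> = (\<Sum>f\<in>V. x f * y f)"
    unfolding y_def by (subst sum.swap) (simp add: sum_distrib_left mult_ac)
  also have "\<dots> = (\<Sum>f\<in>S. x f * y f)"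
    using V by (intro sum.mono_neutral_right) (auto simp: S_def)
  finally have "L\<^sup>2 \<le> (\<Sum>f\<in>S. (x f)\<^sup>2) * (\<Sum>f\<in>S. (y f)\<^sup>2)"
    by (simp add: Cauchy_Schwarz_ineq_sum)
  also have "(\<Sum>f\<in>S. (x f)\<^sup>2) = 1"
    unfolding unit[symmetric] using V by (intro sum.mono_neutral_left) (auto simp: S_def)
  finally have "(L\<^sup>2)\<^sup>2 \<le> (\<Sum>f\<in>S. (y f)\<^sup>2)\<^sup>2" by (intro power_mono) auto
  also have "\<dots> = (\<Sum>f\<in>S. 1 * (y f)\<^sup>2)\<^sup>2" by simp
  also have "\<dots> \<le> (\<Sum>f\<in>S. 1\<^sup>2) * (\<Sum>f\<in>S. ((y f)\<^sup>2)\<^sup>2)"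
    by (rule Cauchy_Schwarz_ineq_sum)
  also have "\<dots> \<le> card S * (\<Sum>f\<in>V. y f ^ 4)"
    using V by (auto simp: S_def simp flip: power_mult intro!: mult_left_mono sum_mono2)
  also have "\<dots> \<le> card S * (card V * (9 ^ l * L\<^sup>2))"
    unfolding y_def L_def W_def using U dual by (intro mult_left_mono fourth_moment_code) auto
  finally have "L\<^sup>2 * L\<^sup>2 \<le> (real (card S) * real (card V) * 9 ^ l) * L\<^sup>2"
    by (simp add: power2_eq_square mult_ac)
  then have "L\<^sup>2 \<le> real (card S) * real (card V) * 9 ^ l"
    by (cases "L = 0") (simp, rule mult_right_le_imp_le[of _ "L\<^sup>2"], simp_all)
  then show ?thesis unfolding L_def c_def W_def S_def .
qed

section \<open>Subspaces of \<open>F\<^sub>2\<^sup>m\<close> and the rejection probability\<close>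

lemma finite_Pts [simp]: "finite (Pts m)"
  by (simp add: Pts_def)

lemma card_Pts: "card (Pts m) = 2 ^ m"
  by (simp add: Pts_def card_Pow)

lemma finite_of_Pts: "x \<in> Pts m \<Longrightarrow> finite x"
  by (auto simp: Pts_def finite_subset)

lemma mem_xorset: "i \<in> xorset x y \<longleftrightarrow> (i \<in> x) \<noteq> (i \<in> y)"
  by (auto simp: xorset_def)

lemma xorset_simps [simp]:
  "xorset x {} = x" "xorset {} x = x" "xorset x x = {}" "xorset x (xorset x y) = y"
  by (auto simp: set_eq_iff mem_xorset)

lemma xorset_assoc: "xorset (xorset x y) z = xorset x (xorset y z)"
  by (auto simp: set_eq_iff mem_xorset)

lemma xorset_left_commute: "xorset x (xorset y z) = xorset y (xorset x z)"
  by (auto simp: set_eq_iff mem_xorset)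

lemma xorset_empty_iff: "xorset x y = {} \<longleftrightarrow> x = y"
  by (auto simp: set_eq_iff mem_xorset)

lemma xorset_Pts: "x \<in> Pts m \<Longrightarrow> y \<in> Pts m \<Longrightarrow> xorset x y \<in> Pts m"
  by (auto simp: Pts_def xorset_def)

lemma odd_card_sym_diff:
  assumes "finite A" "finite B"
  shows "odd (card (sym_diff A B)) \<longleftrightarrow> odd (card A) \<noteq> odd (card B)"
proof -
  have "chi C (\<lambda>_. True) = (if odd (card C) then -1 else 1)" if "finite C" for C :: "'a set"
    using chi_parity[OF that, of "\<lambda>_. True"] by simp
  from this[of A] this[of B] this[of "sym_diff A B"] show ?thesis
    using chi_sym_diff[OF assms, of "\<lambda>_. True"] assms by (simp split: if_splits)
qed

section \<open>Linear algebra over F_2: subset sums, spans, independent tuples\<close>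

lemma mem_vsum: "x \<in> vsum J v \<longleftrightarrow> odd (card {i\<in>J. x \<in> v i})"
  by (simp add: vsum_def)

lemma vsum_empty [simp]: "vsum {} v = {}"
  by (simp add: vsum_def)

text \<open>Index sets form an F_2-space under symmetric difference, and \<open>vsum\<close> is
  linear on it. Spans, independence and the cancellation in the test all rest on this.\<close>

lemma vsum_sym_diff:
  assumes "finite J" "finite K"
  shows "vsum (sym_diff J K) v = xorset (vsum J v) (vsum K v)"
proof -
  have "x \<in> vsum (sym_diff J K) v \<longleftrightarrow> x \<in> xorset (vsum J v) (vsum K v)" for x
  proof -
    have "{i\<in>sym_diff J K. x \<in> v i} = sym_diff {i\<in>J. x \<in> v i} {i\<in>K. x \<in> v i}" by auto
    then show ?thesis
      using assms odd_card_sym_diff[of "{i\<in>J. x \<in> v i}" "{i\<in>K. x \<in> v i}"]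
      by (simp only: mem_vsum mem_xorset) simp
  qed
  then show ?thesis by blast
qed

lemma vsum_singleton [simp]: "vsum {j} v = v j"
proof -
  have "{i. i = j \<and> x \<in> v i} = (if x \<in> v j then {j} else {})" for x by auto
  then show ?thesis by (auto simp: vsum_def)
qed

lemma vsum_insert:
  assumes "finite J" "j \<notin> J"
  shows "vsum (insert j J) v = xorset (v j) (vsum J v)"
proof -
  have "insert j J = sym_diff {j} J" using assms by auto
  then show ?thesis using vsum_sym_diff[of "{j}" J v] assms by simp
qed

lemma vsum_cong: "(\<And>i. i \<in> J \<Longrightarrow> v i = w i) \<Longrightarrow> vsum J v = vsum J w"
proof -
  assume "\<And>i. i \<in> J \<Longrightarrow> v i = w i"
  then have "{i\<in>J. x \<in> v i} = {i\<in>J. x \<in> w i}" for x by auto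
  then show ?thesis by (simp add: vsum_def)
qed

text \<open>Over F_2 closure under addition suffices, as the only scalars are 0 and 1.\<close>

definition subsp :: "nat \<Rightarrow> nat set set \<Rightarrow> bool" where
  "subsp m W \<longleftrightarrow> W \<subseteq> Pts m \<and> {} \<in> W \<and> (\<forall>x\<in>W. \<forall>y\<in>W. xorset x y \<in> W)"

lemma subspD:
  assumes "subsp m W"
  shows "W \<subseteq> Pts m" "{} \<in> W" "\<And>x y. x \<in> W \<Longrightarrow> y \<in> W \<Longrightarrow> xorset x y \<in> W" "finite W"
  using assms by (auto simp: subsp_def intro: finite_subset)

lemma subsp_Pts: "subsp m (Pts m)"
  by (auto simp: subsp_def xorset_Pts) (simp add: Pts_def)

lemma vsum_in_subsp:
  assumes "subsp m W" "finite J" "\<And>i. i \<in> J \<Longrightarrow> v i \<in> W"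
  shows "vsum J v \<in> W"
  using assms(2,3)
  by (induction J rule: finite_induct) (auto simp: vsum_insert subspD[OF assms(1)])

definition spanof :: "nat \<Rightarrow> (nat \<Rightarrow> nat set) \<Rightarrow> nat set set" where
  "spanof k v = (\<lambda>J. vsum J v) ` Pow {..<k}"

lemma spanof_cong: "(\<And>i. i < k \<Longrightarrow> v i = w i) \<Longrightarrow> spanof k v = spanof k w"
  unfolding spanof_def by (intro image_cong refl vsum_cong) auto

lemma spanof_subset:
  assumes "subsp m W" "\<And>i. i < k \<Longrightarrow> v i \<in> W"
  shows "spanof k v \<subseteq> W"
  unfolding spanof_def using assms
  by (auto intro!: vsum_in_subsp[OF assms(1)] intro: finite_subset)

lemma subsp_spanof:
  assumes "\<And>i. i < k \<Longrightarrow> v i \<in> Pts m"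
  shows "subsp m (spanof k v)"
  unfolding subsp_def
proof (intro conjI ballI)
  show "spanof k v \<subseteq> Pts m" using spanof_subset[OF subsp_Pts] assms by blast
  show "{} \<in> spanof k v" unfolding spanof_def by (rule image_eqI[of _ _ "{}"]) auto
  fix x y assume "x \<in> spanof k v" "y \<in> spanof k v"
  then obtain J K where JK: "J \<subseteq> {..<k}" "K \<subseteq> {..<k}" "x = vsum J v" "y = vsum K v"
    by (auto simp: spanof_def)
  then have "finite J" "finite K" by (auto intro: finite_subset)
  then have "xorset x y = vsum (sym_diff J K) v" using vsum_sym_diff[of J K v] JK by simp
  then show "xorset x y \<in> spanof k v" unfolding spanof_def using JK by blast
qed

lemma inj_on_vsum:
  assumes "lin_indep k v"
  shows "inj_on (\<lambda>J. vsum J v) (Pow {..<k})"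
proof (rule inj_onI)
  fix J K assume JK: "J \<in> Pow {..<k}" "K \<in> Pow {..<k}" "vsum J v = vsum K v"
  then have "finite J" "finite K" by (auto intro: finite_subset)
  then have "vsum (sym_diff J K) v = {}" using vsum_sym_diff[of J K v] JK by simp
  moreover have "sym_diff J K \<subseteq> {..<k}" using JK by auto
  ultimately have "sym_diff J K = {}" using assms unfolding lin_indep_def by blast
  then show "J = K" by auto
qed

lemma card_spanof: "lin_indep k v \<Longrightarrow> card (spanof k v) = 2 ^ k"
  unfolding spanof_def by (simp add: card_image inj_on_vsum card_Pow)

lemma lin_indep_cong: "(\<And>i. i < k \<Longrightarrow> v i = w i) \<Longrightarrow> lin_indep k v = lin_indep k w"
  unfolding lin_indep_def using vsum_cong[of _ v w] by (metis lessThan_iff subsetD)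

lemma lin_indep_Suc: "lin_indep (Suc k) v \<longleftrightarrow> lin_indep k v \<and> v k \<notin> spanof k v"
proof (intro iffI conjI)
  assume ind: "lin_indep (Suc k) v"
  show "lin_indep k v"
    using ind unfolding lin_indep_def by (meson lessThan_subset_iff lessI less_imp_le order_trans)
  show "v k \<notin> spanof k v"
  proof
    assume "v k \<in> spanof k v"
    then obtain J where J: "J \<subseteq> {..<k}" "v k = vsum J v" by (auto simp: spanof_def)
    then have "vsum (insert k J) v = {}"
      using finite_subset[OF J(1)] by (subst vsum_insert) auto
    moreover have "insert k J \<subseteq> {..<Suc k}" using J by auto
    ultimately show False using ind unfolding lin_indep_def by blast
  qed
next
  assume ind: "lin_indep k v \<and> v k \<notin> spanof k v"
  show "lin_indep (Suc k) v"
    unfolding lin_indep_def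
  proof (intro allI impI)
    fix J assume J: "J \<subseteq> {..<Suc k}" "J \<noteq> {}"
    show "vsum J v \<noteq> {}"
    proof (cases "k \<in> J")
      case False
      then have "J \<subseteq> {..<k}" using J by (auto simp: less_Suc_eq)
      then show ?thesis using ind J unfolding lin_indep_def by blast
    next
      case True
      define K where "K = J - {k}"
      have K: "K \<subseteq> {..<k}" "k \<notin> K" "J = insert k K"
        using True J by (auto simp: K_def less_Suc_eq)
      then have "vsum J v = xorset (v k) (vsum K v)"
        using vsum_insert finite_subset[OF K(1)] by simp
      then show ?thesis using ind K(1) by (auto simp: xorset_empty_iff spanof_def)
    qed
  qed
qed

definition indeps :: "nat \<Rightarrow> nat set set \<Rightarrow> (nat \<Rightarrow> nat set) set" where
  "indeps k W = {v \<in> Pi\<^sub>E {..<k} (\<lambda>_. W). lin_indep k v}"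

lemma finite_indeps: "finite W \<Longrightarrow> finite (indeps k W)"
  unfolding indeps_def
  by (rule finite_subset[of _ "Pi\<^sub>E {..<k} (\<lambda>_. W)"]) (auto intro: finite_PiE)

text \<open>The vectors are chosen one at a time, each outside the span of its predecessors. The
  truncated subtraction is exact whenever a tuple exists to be extended, since its span of size 2^k
  lies inside W.\<close>

lemma card_indeps:
  assumes W: "subsp m W"
  shows "card (indeps k W) = (\<Prod>i<k. card W - 2 ^ i)"
proof (induction k)
  case 0
  have "indeps 0 W = {\<lambda>_. undefined}" by (auto simp: indeps_def lin_indep_def)
  then show ?case by simp
next
  case (Suc k)
  define S where "S = (SIGMA v:indeps k W. W - spanof k v)"
  have upd: "lin_indep k (v(k := w)) = lin_indep k v" "spanof k (v(k := w)) = spanof k v" for v w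
    by (auto intro!: lin_indep_cong spanof_cong)
  have "bij_betw (\<lambda>(v, w). v(k := w)) S (indeps (Suc k) W)"
    unfolding bij_betw_def
  proof
    show "inj_on (\<lambda>(v, w). v(k := w)) S"
    proof (rule inj_onI, clarify)
      fix v w v' w' assume *: "(v, w) \<in> S" "(v', w') \<in> S" "v(k := w) = v'(k := w')"
      \<comment> \<open>Extensionality fixes the value at k, so v can be recovered from its
        update.\<close>
      have "v k = undefined" "v' k = undefined"
        using *(1,2) by (auto simp: S_def indeps_def PiE_def extensional_def)
      then show "v = v' \<and> w = w'"
        using *(3) by (metis fun_upd_same fun_upd_triv fun_upd_upd)
    qed
    have "v(k := w) \<in> indeps (Suc k) W" if "(v, w) \<in> S" for v w
      using that by (auto simp: S_def indeps_def lin_indep_Suc upd PiE_iff extensional_def less_Suc_eq)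
    moreover have "v \<in> (\<lambda>(v, w). v(k := w)) ` S" if "v \<in> indeps (Suc k) W" for v
    proof (rule image_eqI[of _ _ "(v(k := undefined), v k)"])
      show "(v(k := undefined), v k) \<in> S"
        using that
        by (auto simp: S_def indeps_def lin_indep_Suc upd PiE_iff extensional_def less_Suc_eq)
    qed auto
    ultimately show "(\<lambda>(v, w). v(k := w)) ` S = indeps (Suc k) W" by auto
  qed
  then have "card (indeps (Suc k) W) = card S" using bij_betw_same_card by metis
  also have "\<dots> = (\<Sum>v\<in>indeps k W. card (W - spanof k v))"
    unfolding S_def using subspD(4)[OF W] by (simp add: finite_indeps)
  also have "\<dots> = (\<Sum>v\<in>indeps k W. card W - 2 ^ k)"
  proof (rule sum.cong[OF refl])
    fix v assume v: "v \<in> indeps k W"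
    then have "spanof k v \<subseteq> W" by (intro spanof_subset[OF W]) (auto simp: indeps_def)
    moreover have "card (spanof k v) = 2 ^ k" using v by (auto simp: indeps_def card_spanof)
    ultimately show "card (W - spanof k v) = card W - 2 ^ k"
      using subspD(4)[OF W] by (metis card_Diff_subset finite_subset)
  qed
  finally show ?case using Suc by simp
qed

section \<open>Affine systems and annihilators, counted by characters\<close>

lemma chi_xorset: "chi a (\<lambda>i. i \<in> xorset x y) = chi a (\<lambda>i. i \<in> x) * chi a (\<lambda>i. i \<in> y)"
  unfolding mem_xorset by (rule chi_neq)

lemma chi_vsum:
  assumes "finite J" "\<And>i. i \<in> J \<Longrightarrow> finite (a i)"
  shows "chi (vsum J a) f = (\<Prod>i\<in>J. chi (a i) f)"
  using assms
proof (induction J rule: finite_induct)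
  case (insert j J)
  have "vsum J a \<subseteq> (\<Union>i\<in>J. a i)" by (auto simp: mem_vsum elim: oddE dest!: odd_card_imp_not_empty)
  then have "finite (vsum J a)" using insert by (auto intro: finite_subset)
  then show ?case using insert chi_sym_diff[of "a j" "vsum J a" f]
    by (simp add: vsum_insert xorset_def)
qed simp

lemma chi_mem_parity: "finite a \<Longrightarrow> chi a (\<lambda>i. i \<in> x) = (if odd (card (a \<inter> x)) then -1 else 1)"
  by (simp add: chi_parity Int_def)

text \<open>The solution set has indicator 2^(-d) times a product of factors 1 \<plusminus>
  \<open>chi\<close>. Expanded over subsets J of the equations, independence makes every nonempty J
  a nontrivial character, which sums to 0.\<close>

lemma card_aff_solutions:
  assumes a: "\<And>i. i < d \<Longrightarrow> a i \<subseteq> {..<m}" and ind: "lin_indep d a"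
  shows "card {x\<in>Pts m. \<forall>i<d. aff (a i) (b i) x} * 2 ^ d = 2 ^ m"
proof -
  \<comment> \<open>\<open>aff\<close> with b true asks for even parity, that is, character value 1;
    hence the sign.\<close>
  define e where "e = (\<lambda>i. if b i then 1 else -1 :: real)"
  have fin: "finite (a i)" if "i < d" for i using a[OF that] finite_subset by blast
  have ind1: "(\<Prod>i<d. 1 + e i * chi (a i) (\<lambda>j. j \<in> x)) = 2 ^ d * of_bool (\<forall>i<d. aff (a i) (b i) x)" for x
  proof -
    have "(\<Prod>i<d. 1 + e i * chi (a i) (\<lambda>j. j \<in> x)) = (\<Prod>i<d. 2 * of_bool (aff (a i) (b i) x))"
      using fin by (intro prod.cong) (auto simp: e_def chi_mem_parity aff_def)
    then show ?thesis by (auto simp: prod.distrib of_bool_def prod_zero_iff)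
  qed
  have "real (card {x\<in>Pts m. \<forall>i<d. aff (a i) (b i) x} * 2 ^ d)
     = (\<Sum>x\<in>Pts m. \<Prod>i<d. 1 + e i * chi (a i) (\<lambda>j. j \<in> x))"
    unfolding ind1 sum_distrib_left[symmetric] by (simp add: of_bool_def sum.If_cases Int_def)
  also have "\<dots> = (\<Sum>x\<in>Pts m. \<Sum>J\<in>Pow {..<d}. \<Prod>i\<in>J. e i * chi (a i) (\<lambda>j. j \<in> x))"
    by (simp add: sum_Pow_prod)
  also have "\<dots> = (\<Sum>J\<in>Pow {..<d}. (\<Prod>i\<in>J. e i) * (\<Sum>x\<in>Pts m. chi (vsum J a) (\<lambda>j. j \<in> x)))"
  proof (subst sum.swap, rule sum.cong[OF refl])
    fix J assume "J \<in> Pow {..<d}"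
    then have "finite J" "\<And>i. i \<in> J \<Longrightarrow> finite (a i)" using fin finite_subset by auto
    then show "(\<Sum>x\<in>Pts m. \<Prod>i\<in>J. e i * chi (a i) (\<lambda>j. j \<in> x))
        = (\<Prod>i\<in>J. e i) * (\<Sum>x\<in>Pts m. chi (vsum J a) (\<lambda>j. j \<in> x))"
      by (simp add: chi_vsum prod.distrib sum_distrib_left)
  qed
  also have "\<dots> = (\<Sum>J\<in>Pow {..<d}. if J = {} then 2 ^ m else 0)"
  proof (rule sum.cong[OF refl])
    fix J assume J: "J \<in> Pow {..<d}"
    have "vsum J a \<in> Pts m"
      using a J by (intro vsum_in_subsp[OF subsp_Pts]) (auto simp: Pts_def intro: finite_subset)
    then have "(\<Sum>x\<in>Pts m. chi (vsum J a) (\<lambda>j. j \<in> x)) = (if vsum J a = {} then 2 ^ m else 0)"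
      unfolding Pts_def by (subst sum_Pow_chi_mem) auto
    moreover have "vsum J a = {} \<longleftrightarrow> J = {}"
      using ind J unfolding lin_indep_def by auto
    ultimately show "(\<Prod>i\<in>J. e i) * (\<Sum>x\<in>Pts m. chi (vsum J a) (\<lambda>j. j \<in> x)) = (if J = {} then 2 ^ m else 0)"
      by simp
  qed
  also have "\<dots> = real (2 ^ m)" by (simp add: sum.delta)
  finally show ?thesis by (simp only: of_nat_eq_iff)
qed

definition ann :: "nat \<Rightarrow> nat set set \<Rightarrow> nat set set" where
  "ann m W = {a\<in>Pts m. \<forall>w\<in>W. even (card (a \<inter> w))}"

lemma even_card_Int_xorset:
  assumes "finite a"
  shows "even (card (a \<inter> xorset x y)) \<longleftrightarrow> even (card (a \<inter> x)) = even (card (a \<inter> y))"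
  using chi_xorset[of a x y] assms by (simp add: chi_mem_parity split: if_splits)

lemma subsp_ann:
  assumes "subsp m W"
  shows "subsp m (ann m W)"
  unfolding subsp_def
proof (intro conjI ballI)
  show "ann m W \<subseteq> Pts m" "{} \<in> ann m W" by (auto simp: ann_def Pts_def)
  fix x y assume xy: "x \<in> ann m W" "y \<in> ann m W"
  have "even (card (xorset x y \<inter> w))" if "w \<in> W" for w
  proof -
    have "finite w" using that subspD(1)[OF assms] finite_of_Pts by blast
    then show ?thesis using xy that even_card_Int_xorset[of w x y]
      by (simp add: ann_def Int_commute)
  qed
  then show "xorset x y \<in> ann m W" using xy by (auto simp: ann_def xorset_Pts)
qed

text \<open>The character sum over all pairs (a, w) is evaluated in both orders: for fixed a only
  the annihilator contributes, for fixed w only the zero vector.\<close>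

lemma card_ann:
  assumes W: "subsp m W"
  shows "card (ann m W) * card W = 2 ^ m"
proof -
  have inner: "(\<Sum>w\<in>W. chi a (\<lambda>i. i \<in> w)) = (if a \<in> ann m W then real (card W) else 0)"
    if a: "a \<in> Pts m" for a
  proof (cases "a \<in> ann m W")
    case True
    then have "chi a (\<lambda>i. i \<in> w) = 1" if "w \<in> W" for w
      using that finite_of_Pts[OF a] by (simp add: chi_mem_parity ann_def)
    then show ?thesis using True by simp
  next
    case False
    then obtain w0 where w0: "w0 \<in> W" "chi a (\<lambda>i. i \<in> w0) = -1"
      using a finite_of_Pts[OF a] by (auto simp: ann_def chi_mem_parity)
    have "(\<Sum>w\<in>W. chi a (\<lambda>i. i \<in> w)) = (\<Sum>w\<in>W. chi a (\<lambda>i. i \<in> xorset w0 w))"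
      by (rule sum.reindex_bij_witness[of _ "xorset w0" "xorset w0"])
         (use subspD(3)[OF W] w0 in auto)
    also have "\<dots> = - (\<Sum>w\<in>W. chi a (\<lambda>i. i \<in> w))"
      unfolding chi_xorset w0 by (simp add: sum_negf)
    finally show ?thesis using False by simp
  qed
  have "real (card (ann m W) * card W) = (\<Sum>a\<in>Pts m. if a \<in> ann m W then real (card W) else 0)"
    by (simp add: sum.If_cases Int_absorb1 ann_def Int_def)
  also have "\<dots> = (\<Sum>a\<in>Pts m. \<Sum>w\<in>W. chi a (\<lambda>i. i \<in> w))"
    using inner by simp
  also have "\<dots> = (\<Sum>w\<in>W. \<Sum>a\<in>Pts m. chi a (\<lambda>i. i \<in> w))" by (rule sum.swap)
  also have "\<dots> = (\<Sum>w\<in>W. if w = {} then 2 ^ m else 0)"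
    using subspD(1)[OF W] unfolding Pts_def by (intro sum.cong refl) (auto simp: sum_Pow_chi)
  also have "\<dots> = real (2 ^ m)" using subspD(2,4)[OF W] by (simp add: sum.delta)
  finally show ?thesis by (simp only: of_nat_eq_iff)
qed

text \<open>The indicator of p + W: in characteristic 2, subtracting p is adding p.\<close>

definition coset_ind :: "nat \<Rightarrow> nat set set \<Rightarrow> nat set \<Rightarrow> nat set \<Rightarrow> bool" where
  "coset_ind m W p = (\<lambda>x\<in>Pts m. xorset p x \<in> W)"

text \<open>The constant is chosen so that p itself satisfies the form, which then becomes linear in
  p + x.\<close>

lemma aff_coset:
  assumes "finite a"
  shows "aff a (even (card (a \<inter> p))) x \<longleftrightarrow> even (card (a \<inter> xorset p x))"
  using even_card_Int_xorset[OF assms, of p x] by (auto simp: aff_def)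

text \<open>The annihilator of W has 2^d elements, so the count of independent tuples in it is positive;
  any such tuple cuts out exactly the coset, by cardinality.\<close>

lemma coset_ind_in_Tgen:
  assumes W: "subsp m W" "card W = 2 ^ (m - d)" and d: "d \<le> m" and p: "p \<in> Pts m"
  shows "coset_ind m W p \<in> Tgen m d"
proof -
  have "card (ann m W) * 2 ^ (m - d) = 2 ^ d * 2 ^ (m - d)"
    using card_ann[OF W(1)] W(2) d by (simp flip: power_add)
  then have "card (ann m W) = 2 ^ d" by simp
  then have "card (indeps d (ann m W)) = (\<Prod>i<d. 2 ^ d - 2 ^ i)"
    using card_indeps[OF subsp_ann[OF W(1)]] by simp
  also have "\<dots> > 0" by (simp add: prod_pos)
  finally obtain a where a: "a \<in> indeps d (ann m W)"
    by (metis card_gt_0_iff ex_in_conv)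
  define b where "b = (\<lambda>i. even (card (a i \<inter> p)))"
  have ai: "a i \<in> ann m W" if "i < d" for i using a that by (auto simp: indeps_def)
  have sub: "a i \<subseteq> {..<m}" "finite (a i)" if "i < d" for i
    using ai[OF that] finite_of_Pts by (auto simp: ann_def Pts_def intro: finite_subset)
  have ind: "lin_indep d a" using a by (simp add: indeps_def)
  let ?S = "{x\<in>Pts m. \<forall>i<d. aff (a i) (b i) x}"
  have "card ?S * 2 ^ d = 2 ^ (m - d) * 2 ^ d"
    using card_aff_solutions[OF sub(1) ind, of b] d by (simp flip: power_add)
  then have cS: "card ?S = 2 ^ (m - d)" by simp
  have img: "xorset p ` W \<subseteq> ?S"
    using ai subspD(1)[OF W(1)] p sub by (auto simp: b_def aff_coset ann_def intro: xorset_Pts)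
  have "card (xorset p ` W) = 2 ^ (m - d)"
    unfolding W(2)[symmetric] by (rule card_image) (metis inj_onI xorset_simps(4))
  then have eq: "xorset p ` W = ?S" using img cS by (intro card_subset_eq) auto
  have "coset_ind m W p = (\<lambda>x\<in>Pts m. \<forall>i<d. aff (a i) (b i) x)"
    unfolding coset_ind_def
  proof (rule restrict_ext)
    fix x assume x: "x \<in> Pts m"
    have "xorset p x \<in> W \<longleftrightarrow> x \<in> xorset p ` W" by (metis imageE imageI xorset_simps(4))
    then show "(xorset p x \<in> W) = (\<forall>i<d. aff (a i) (b i) x)" using eq x by simp
  qed
  then show ?thesis unfolding Tgen_def using sub ind by blast
qed

text \<open>W solves the homogeneous system and p is any solution of the given one. The solution
  count does not depend on the constants, so it provides both the size of W and the existence of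
  p.\<close>

lemma Tgen_coset:
  assumes h: "h \<in> Tgen m d" and d: "d \<le> m"
  obtains W p where "subsp m W" "card W = 2 ^ (m - d)" "p \<in> Pts m" "h = coset_ind m W p"
proof -
  obtain a b where ab: "h = (\<lambda>x\<in>Pts m. \<forall>i<d. aff (a i) (b i) x)"
    "\<And>i. i < d \<Longrightarrow> a i \<subseteq> {..<m}" "lin_indep d a"
    using h by (auto simp: Tgen_def)
  have fin: "finite (a i)" if "i < d" for i using ab(2)[OF that] finite_subset by blast
  have cnt: "card {x\<in>Pts m. \<forall>i<d. aff (a i) (b i) x} = 2 ^ (m - d)" for b
  proof -
    have "card {x\<in>Pts m. \<forall>i<d. aff (a i) (b i) x} * 2 ^ d = 2 ^ (m - d) * 2 ^ d"
      using card_aff_solutions[OF ab(2,3), of b] d by (simp flip: power_add)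
    then show ?thesis by simp
  qed
  define W where "W = {x\<in>Pts m. \<forall>i<d. even (card (a i \<inter> x))}"
  \<comment> \<open>With constant \<open>True\<close> the form \<open>aff\<close> is the homogeneous
    equation.\<close>
  have "W = {x\<in>Pts m. \<forall>i<d. aff (a i) True x}" by (auto simp: W_def aff_def)
  then have cW: "card W = 2 ^ (m - d)" using cnt[of "\<lambda>_. True"] by simp
  have W: "subsp m W"
    unfolding subsp_def W_def using fin
    by (auto simp: even_card_Int_xorset xorset_Pts) (simp add: Pts_def)
  have "{x\<in>Pts m. \<forall>i<d. aff (a i) (b i) x} \<noteq> {}"
    using cnt[of b] by (metis card.empty power_not_zero zero_neq_numeral)
  then obtain p where p: "p \<in> Pts m" "\<And>i. i < d \<Longrightarrow> aff (a i) (b i) p" by auto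
  have "h = coset_ind m W p"
    unfolding ab(1) coset_ind_def
  proof (rule restrict_ext)
    fix x assume x: "x \<in> Pts m"
    have "aff (a i) (b i) x \<longleftrightarrow> even (card (a i \<inter> xorset p x))" if "i < d" for i
      using p(2)[OF that] even_card_Int_xorset[OF fin[OF that], of p x] by (auto simp: aff_def)
    then show "(\<forall>i<d. aff (a i) (b i) x) = (xorset p x \<in> W)"
      using x p(1) by (auto simp: W_def xorset_Pts)
  qed
  then show ?thesis using that W cW p(1) by blast
qed

lemma finite_Tgen: "finite (Tgen m d)"
proof (rule finite_subset)
  show "Tgen m d \<subseteq> Pi\<^sub>E (Pts m) (\<lambda>_. UNIV)" by (auto simp: Tgen_def)
qed (auto intro: finite_PiE)

lemma card_Tgen_support:
  assumes "h \<in> Tgen m d" "d \<le> m"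
  shows "card {x\<in>Pts m. h x} = 2 ^ (m - d)"
proof -
  obtain W p where W: "subsp m W" "card W = 2 ^ (m - d)" "p \<in> Pts m" "h = coset_ind m W p"
    using Tgen_coset[OF assms] .
  have "{x\<in>Pts m. h x} = xorset p ` W"
    using subspD(1)[OF W(1)] W(3) unfolding W(4) coset_ind_def
    by (auto simp: xorset_Pts intro!: image_eqI[of _ "xorset p" "xorset p _"])
  moreover have "inj_on (xorset p) W" by (metis inj_onI xorset_simps(4))
  ultimately show ?thesis using W(2) by (simp add: card_image)
qed

text \<open>With equal cardinalities, inclusion already forces U = W. This form separates the
  condition on the base point from the one on the directions, so the pairs describing one generator
  form a product set.\<close>

lemma coset_ind_eq_iff:
  assumes W: "subsp m W" and U: "subsp m U" "card U = card W" and p: "p \<in> Pts m" and q: "q \<in> Pts m"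
  shows "coset_ind m U q = coset_ind m W p \<longleftrightarrow> coset_ind m W p q \<and> U \<subseteq> W"
proof
  assume eq: "coset_ind m U q = coset_ind m W p"
  have iff: "xorset q x \<in> U \<longleftrightarrow> xorset p x \<in> W" if "x \<in> Pts m" for x
    using fun_cong[OF eq, of x] that by (simp add: coset_ind_def)
  have qW: "xorset p q \<in> W" using iff[OF q] subspD(2)[OF U(1)] by simp
  have "u \<in> W" if u: "u \<in> U" for u
  proof -
    have "xorset p (xorset q u) \<in> W"
      using iff[of "xorset q u"] u subspD(1)[OF U(1)] q by (auto simp: xorset_Pts)
    then have "xorset (xorset p q) (xorset p (xorset q u)) \<in> W" using subspD(3)[OF W] qW by blast
    then show ?thesis by (simp add: xorset_assoc xorset_left_commute[of q])
  qed
  then show "coset_ind m W p q \<and> U \<subseteq> W" using qW q by (auto simp: coset_ind_def)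
next
  assume *: "coset_ind m W p q \<and> U \<subseteq> W"
  then have UW: "U = W" using card_subset_eq[OF subspD(4)[OF W]] U(2) by auto
  have qW: "xorset p q \<in> W" using * q by (simp add: coset_ind_def)
  show "coset_ind m U q = coset_ind m W p"
    unfolding coset_ind_def UW
  proof (rule restrict_ext)
    fix x
    have "xorset q x = xorset (xorset p q) (xorset p x)" "xorset p x = xorset (xorset p q) (xorset q x)"
      by (auto simp: set_eq_iff mem_xorset)
    then show "(xorset q x \<in> W) = (xorset p x \<in> W)" using subspD(3)[OF W qW] by metis
  qed
qed

text \<open>Adding J is a fixed-point-free involution on the index sets.\<close>

lemma even_card_dependent:
  assumes k: "finite I" and J: "J \<subseteq> I" "J \<noteq> {}" "vsum J v = {}"
  shows "even (card {S \<in> Pow I. f (xorset a (vsum S v))})"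
proof -
  obtain j where j: "j \<in> J" using J by auto
  let ?X = "{S \<in> Pow I. f (xorset a (vsum S v)) \<and> j \<in> S}"
  let ?Y = "{S \<in> Pow I. f (xorset a (vsum S v)) \<and> j \<notin> S}"
  have inv: "vsum (sym_diff J S) v = vsum S v" if "S \<subseteq> I" for S
    using that J k by (subst vsum_sym_diff) (auto intro: finite_subset)
  have "bij_betw (sym_diff J) ?X ?Y"
    by (rule bij_betw_byWitness[of _ "sym_diff J"]) (use inv j J in \<open>auto simp: subset_iff\<close>)
  then have "card ?X = card ?Y" by (rule bij_betw_same_card)
  moreover have "card {S \<in> Pow I. f (xorset a (vsum S v))} = card ?X + card ?Y"
    using k by (subst card_Un_disjoint[symmetric]) (auto intro!: arg_cong[where f=card])
  ultimately show ?thesis by simp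
qed

text \<open>For independent directions the test queries each point of the affine subspace exactly
  once.\<close>

lemma card_indep_sum:
  assumes v: "v \<in> indeps k (Pts m)" and a: "a \<in> Pts m"
  shows "card {S \<in> Pow {..<k}. f (xorset a (vsum S v))}
    = card {x\<in>Pts m. coset_ind m (spanof k v) a x \<and> f x}"
proof (rule bij_betw_same_card)
  have sub: "spanof k v \<subseteq> Pts m"
    using v by (intro spanof_subset[OF subsp_Pts]) (auto simp: indeps_def)
  let ?g = "\<lambda>S. xorset a (vsum S v)"
  have inj: "inj_on ?g (Pow {..<k})"
  proof (rule inj_onI)
    fix S S' assume *: "S \<in> Pow {..<k}" "S' \<in> Pow {..<k}" "?g S = ?g S'"
    from *(3) have "vsum S v = vsum S' v" by (metis xorset_simps(4))
    then show "S = S'" using inj_onD[OF inj_on_vsum _ *(1,2)] v by (auto simp: indeps_def)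
  qed
  have "x \<in> ?g ` {S \<in> Pow {..<k}. f (?g S)}"
    if x: "x \<in> Pts m" "coset_ind m (spanof k v) a x" "f x" for x
  proof -
    obtain S where "S \<subseteq> {..<k}" "xorset a x = vsum S v"
      using x by (auto simp: coset_ind_def spanof_def)
    moreover from this have "x = ?g S" by (metis xorset_simps(4))
    ultimately show ?thesis using x by blast
  qed
  moreover have "?g S \<in> Pts m \<and> coset_ind m (spanof k v) a (?g S)" if "S \<subseteq> {..<k}" for S
  proof -
    have "vsum S v \<in> spanof k v" using that by (auto simp: spanof_def)
    moreover have "?g S \<in> Pts m" using calculation sub a by (blast intro: xorset_Pts)
    ultimately show ?thesis by (simp add: coset_ind_def)
  qed
  ultimately show "bij_betw ?g {S \<in> Pow {..<k}. f (?g S)} {x\<in>Pts m. coset_ind m (spanof k v) a x \<and> f x}"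
    unfolding bij_betw_def using inj by (auto intro: inj_on_subset)
qed

text \<open>Dependent directions never reject, and every generator is the indicator of an affine subspace
  that arises from the same number F of pairs of a base point and independent directions.\<close>

lemma rm_rej_le:
  assumes d: "d < m"
  shows "rm_rej m (m - d - 1) f
    \<le> card {h\<in>Tgen m d. odd (card {x\<in>Pts m. h x \<and> f x})} / card (Tgen m d)"
proof -
  define k where "k = m - d"
  \<comment> \<open>The test for degree m-d-1 uses one direction more than the degree: m-d of them,
    the dimension of a generator's support.\<close>
  have k: "{..m - d - 1} = {..<k}" "m - d - 1 + 1 = k" using d by (auto simp: k_def)
  define Q where "Q = Pts m \<times> indeps k (Pts m)"
  define H where "H = (\<lambda>(a, v). coset_ind m (spanof k v) a)"
  \<comment> \<open>The choices of a base point in the coset times those of an ordered basis of its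
    direction space.\<close>
  define F where "F = 2 ^ k * (\<Prod>i<k. 2 ^ k - 2 ^ i :: nat)"
  define P where "P = (\<lambda>h. odd (card {x\<in>Pts m. h x \<and> f x}))"
  have finQ: "finite Q" by (simp add: Q_def finite_indeps)
  have spv: "subsp m (spanof k v)" "card (spanof k v) = 2 ^ k" if "v \<in> indeps k (Pts m)" for v
    using that by (auto simp: indeps_def card_spanof intro!: subsp_spanof)
  have HT: "H q \<in> Tgen m d" if "q \<in> Q" for q
    using that spv d unfolding H_def Q_def k_def by (auto intro!: coset_ind_in_Tgen)
  have fibre: "card {q\<in>Q. H q = h} = F" if h: "h \<in> Tgen m d" for h
  proof -
    obtain W p where W: "subsp m W" "card W = 2 ^ (m - d)" "p \<in> Pts m" "h = coset_ind m W p"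
      using Tgen_coset[OF h] d by auto
    have "H (a, v) = h \<longleftrightarrow> h a \<and> (\<forall>i<k. v i \<in> W)" if av: "a \<in> Pts m" "v \<in> indeps k (Pts m)" for a v
    proof -
      have "spanof k v \<subseteq> W \<longleftrightarrow> (\<forall>i<k. v i \<in> W)"
      proof
        assume "spanof k v \<subseteq> W"
        moreover have "v i \<in> spanof k v" if "i < k" for i
          unfolding spanof_def using that by (intro image_eqI[of _ _ "{i}"]) auto
        ultimately show "\<forall>i<k. v i \<in> W" by blast
      qed (use spanof_subset[OF W(1)] in blast)
      then show ?thesis
        unfolding H_def W(4) using coset_ind_eq_iff[OF W(1) spv(1)[OF av(2)] _ W(3) av(1)] spv(2)[OF av(2)] W(2)
        by (simp add: k_def)
    qed
    then have "{q\<in>Q. H q = h} = {x\<in>Pts m. h x} \<times> indeps k W"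
      using subspD(1)[OF W(1)] unfolding Q_def
      by (auto simp: indeps_def PiE_iff)
    then show ?thesis
      using card_Tgen_support[OF h] card_indeps[OF W(1)] W(2) d
      by (simp add: card_cartesian_product F_def k_def)
  qed
  have count: "card {q\<in>Q. R (H q)} = card {h\<in>Tgen m d. R h} * F" for R
  proof -
    have "card {q\<in>Q. R (H q)} = (\<Sum>h\<in>{h\<in>Tgen m d. R h}. card {q\<in>{q\<in>Q. R (H q)}. H q = h})"
      unfolding card_eq_sum using finQ finite_Tgen[of m d] HT
      by (intro sum.group[symmetric]) (simp_all add: image_subset_iff)
    also have "\<dots> = (\<Sum>h\<in>{h\<in>Tgen m d. R h}. F)"
    proof (rule sum.cong[OF refl])
      fix h assume "h \<in> {h\<in>Tgen m d. R h}"
      moreover from this have "{q\<in>{q\<in>Q. R (H q)}. H q = h} = {q\<in>Q. H q = h}" by auto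
      ultimately show "card {q\<in>{q\<in>Q. R (H q)}. H q = h} = F" using fibre by simp
    qed
    finally show ?thesis by simp
  qed
  have rej: "{(a, v). a \<in> Pts m \<and> v \<in> Pi\<^sub>E {..m - d - 1} (\<lambda>_. Pts m) \<and>
      odd (card {S \<in> Pow {..m - d - 1}. f (xorset a (vsum S v))})} = {q\<in>Q. P (H q)}"
  proof -
    have "(a \<in> Pts m \<and> v \<in> Pi\<^sub>E {..<k} (\<lambda>_. Pts m) \<and>
      odd (card {S \<in> Pow {..<k}. f (xorset a (vsum S v))})) \<longleftrightarrow> (a, v) \<in> Q \<and> P (H (a, v))" for a v
    proof (cases "lin_indep k v")
      case True
      then show ?thesis using card_indep_sum[of v k m a f]
        by (auto simp: Q_def H_def P_def indeps_def)
    next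
      case False
      then obtain J where "J \<subseteq> {..<k}" "J \<noteq> {}" "vsum J v = {}" by (auto simp: lin_indep_def)
      then have "even (card {S \<in> Pow {..<k}. f (xorset a (vsum S v))})"
        by (intro even_card_dependent) auto
      then show ?thesis using False by (auto simp: Q_def indeps_def)
    qed
    then show ?thesis unfolding k by auto
  qed
  have T0: "card (Tgen m d) * F = card Q" using count[of "\<lambda>_. True"] by simp
  have "card (indeps k (Pts m)) = (\<Prod>i<k. 2 ^ m - 2 ^ i)"
    using card_indeps[OF subsp_Pts] by (simp add: card_Pts)
  also have "\<dots> > 0" by (rule prod_pos) (auto simp: k_def)
  finally have Q0: "card Q > 0" by (simp add: Q_def card_cartesian_product card_Pts)
  have "card (indeps k (Pts m)) \<le> card (Pi\<^sub>E {..<k} (\<lambda>_. Pts m))"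
    unfolding indeps_def by (intro card_mono finite_PiE) auto
  then have "card Q \<le> 2 ^ m * 2 ^ (m * k)"
    by (simp add: Q_def card_cartesian_product card_Pts card_PiE power_mult)
  then have Qle: "real (card Q) \<le> 2 ^ m * 2 ^ (m * k)" by (simp flip: of_nat_le_iff[where 'a=real])
  have "rm_rej m (m - d - 1) f = card {h\<in>Tgen m d. P h} * F / (2 ^ m * 2 ^ (m * k))"
    by (simp only: rm_rej_def rej count[of P] k(2) of_nat_mult)
  \<comment> \<open>Dropping the dependent tuples from the sample space shrinks the denominator
    only.\<close>
  also have "\<dots> \<le> card {h\<in>Tgen m d. P h} * F / card Q"
    using Qle Q0 by (intro divide_left_mono) auto
  also have "\<dots> = card {h\<in>Tgen m d. P h} / card (Tgen m d)"
    using Q0 unfolding T0[symmetric] by simp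
  finally show ?thesis unfolding P_def .
qed

section \<open>Reed--Muller codes\<close>

definition monoms :: "nat \<Rightarrow> nat \<Rightarrow> nat set set" where
  "monoms m d = {S. S \<subseteq> {..<m} \<and> card S \<le> d}"

lemma finite_monoms [simp]: "finite (monoms m d)"
  unfolding monoms_def by (rule finite_subset[of _ "Pow {..<m}"]) auto

definition polyf :: "nat \<Rightarrow> nat set set \<Rightarrow> nat set \<Rightarrow> bool" where
  "polyf m C = (\<lambda>x\<in>Pts m. odd (card {S\<in>C. S \<subseteq> x}))"

lemma RM_eq: "RM m d = polyf m ` Pow (monoms m d)"
  by (auto simp: RM_def polyf_def monoms_def)

lemma finite_RM [simp]: "finite (RM m d)"
  by (simp add: RM_eq)

lemma card_RM_le: "card (RM m d) \<le> 2 ^ card (monoms m d)"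
  unfolding RM_eq by (rule order_trans[OF card_image_le]) (auto simp: card_Pow)

lemma RM_extensional: "f \<in> RM m d \<Longrightarrow> f \<in> extensional (Pts m)"
  by (auto simp: RM_eq polyf_def)

lemma polyf_sym_diff:
  assumes "finite C" "finite D"
  shows "polyf m (sym_diff C D) = fadd m (polyf m C) (polyf m D)"
  unfolding fadd_def
  unfolding polyf_def
proof (rule restrict_ext)
  fix x assume "x \<in> Pts m"
  have "{S\<in>sym_diff C D. S \<subseteq> x} = sym_diff {S\<in>C. S \<subseteq> x} {S\<in>D. S \<subseteq> x}" by auto
  then show "odd (card {S\<in>sym_diff C D. S \<subseteq> x}) = ((\<lambda>x\<in>Pts m. odd (card {S\<in>C. S \<subseteq> x})) x \<noteq>
      (\<lambda>x\<in>Pts m. odd (card {S\<in>D. S \<subseteq> x})) x)"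
    using assms odd_card_sym_diff[of "{S\<in>C. S \<subseteq> x}" "{S\<in>D. S \<subseteq> x}"] \<open>x \<in> Pts m\<close>
    by (simp only: restrict_apply if_True) simp
qed

lemma RM_fadd:
  assumes "f \<in> RM m d" "g \<in> RM m d"
  shows "fadd m f g \<in> RM m d"
proof -
  obtain C D where CD: "C \<subseteq> monoms m d" "D \<subseteq> monoms m d" "f = polyf m C" "g = polyf m D"
    using assms by (auto simp: RM_eq)
  then have "finite C" "finite D" by (auto intro: finite_subset)
  then have "fadd m f g = polyf m (sym_diff C D)" using CD polyf_sym_diff[of C D m] by simp
  then show ?thesis unfolding RM_eq using CD by blast
qed

lemma polyf_empty: "polyf m {} = (\<lambda>x\<in>Pts m. False)"
  by (simp add: polyf_def)

lemma polyf_singleton: "polyf m {S} = (\<lambda>x\<in>Pts m. S \<subseteq> x)"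
proof -
  have "{S'. S' = S \<and> S' \<subseteq> x} = (if S \<subseteq> x then {S} else {})" for x by auto
  then show ?thesis by (auto simp: polyf_def)
qed

lemma RM_zero: "(\<lambda>x\<in>Pts m. False) \<in> RM m d"
  unfolding RM_eq polyf_empty[symmetric] by blast

lemma RM_monomial: "S \<subseteq> {..<m} \<Longrightarrow> card S \<le> d \<Longrightarrow> (\<lambda>x\<in>Pts m. S \<subseteq> x) \<in> RM m d"
  unfolding RM_eq polyf_singleton[symmetric] by (auto simp: monoms_def)

text \<open>Codewords are built one monomial at a time, so additive properties need checking on
  monomials only.\<close>

lemma RM_induct [consumes 1, case_names zero add]:
  assumes "f \<in> RM m d"
    and zero: "P (\<lambda>x\<in>Pts m. False)"
    and add: "\<And>S g. S \<subseteq> {..<m} \<Longrightarrow> card S \<le> d \<Longrightarrow> g \<in> RM m d \<Longrightarrow> P g \<Longrightarrow> P (fadd m (\<lambda>x\<in>Pts m. S \<subseteq> x) g)"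
  shows "P f"
proof -
  obtain C where C: "C \<subseteq> monoms m d" "f = polyf m C" using assms(1) by (auto simp: RM_eq)
  have "finite C" using C(1) by (auto intro: finite_subset)
  then have "P (polyf m C)" using C(1)
  proof (induction C rule: finite_induct)
    case empty
    show ?case unfolding polyf_empty by (rule zero)
  next
    case (insert S C)
    have "insert S C = sym_diff {S} C" using insert by auto
    then have "polyf m (insert S C) = fadd m (\<lambda>x\<in>Pts m. S \<subseteq> x) (polyf m C)"
      using polyf_sym_diff[of "{S}" C m] insert by (simp add: polyf_singleton)
    moreover have "polyf m C \<in> RM m d" using insert by (auto simp: RM_eq)
    ultimately show ?case using insert add[of S "polyf m C"] by (auto simp: monoms_def)
  qed
  then show ?thesis using C(2) by simp
qed

lemma RM_degree_mono: "d \<le> e \<Longrightarrow> RM m d \<subseteq> RM m e"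
  unfolding RM_eq monoms_def by (intro image_mono Pow_mono) auto

text \<open>Since x_j^2 = x_j, multiplying the monomial S by x_j gives \<open>insert j S\<close>.
  Different monomials may merge; arguing with functions and \<open>fadd\<close> lets them cancel by
  themselves.\<close>

lemma RM_mult_var:
  assumes "f \<in> RM m d" "j < m"
  shows "(\<lambda>x\<in>Pts m. f x \<and> j \<in> x) \<in> RM m (Suc d)"
  using assms(1)
proof (induction rule: RM_induct)
  case zero
  have "(\<lambda>x\<in>Pts m. (\<lambda>x\<in>Pts m. False) x \<and> j \<in> x) = (\<lambda>x\<in>Pts m. False)" by (auto intro: restrict_ext)
  then show ?case using RM_zero by (simp only:)
next
  case (add S g)
  have "card (insert j S) \<le> Suc d" using add card_insert_le_m1[of "Suc d" S j] by simp
  then have "(\<lambda>x\<in>Pts m. insert j S \<subseteq> x) \<in> RM m (Suc d)"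
    using add assms(2) by (intro RM_monomial) auto
  from RM_fadd[OF this add.IH]
  have "fadd m (\<lambda>x\<in>Pts m. insert j S \<subseteq> x) (\<lambda>x\<in>Pts m. g x \<and> j \<in> x) \<in> RM m (Suc d)" .
  moreover have "fadd m (\<lambda>x\<in>Pts m. insert j S \<subseteq> x) (\<lambda>x\<in>Pts m. g x \<and> j \<in> x)
      = (\<lambda>x\<in>Pts m. fadd m (\<lambda>x\<in>Pts m. S \<subseteq> x) g x \<and> j \<in> x)"
    unfolding fadd_def by (rule restrict_ext) auto
  ultimately show ?case by (simp only:)
qed

lemma RM_mult_aff:
  assumes f: "f \<in> RM m d" and a: "a \<subseteq> {..<m}"
  shows "(\<lambda>x\<in>Pts m. f x \<and> aff a b x) \<in> RM m (Suc d)"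
proof -
  have "finite a" using a finite_subset by blast
  then show ?thesis using a
  proof (induction a rule: finite_induct)
    case empty
    have "f \<in> RM m (Suc d)" using f RM_degree_mono[of d "Suc d"] by auto
    moreover have "(\<lambda>x\<in>Pts m. f x \<and> aff {} b x) = (if b then f else (\<lambda>x\<in>Pts m. False))"
      using RM_extensional[OF f] by (auto simp: aff_def restrict_def extensional_def fun_eq_iff)
    ultimately show ?case using RM_zero by simp
  next
    case (insert j a)
    have "aff (insert j a) b x = ((j \<in> x) \<noteq> aff a b x)" for x
      using insert by (cases "j \<in> x") (auto simp: aff_def Int_insert_left)
    then have "(\<lambda>x\<in>Pts m. f x \<and> aff (insert j a) b x)
       = fadd m (\<lambda>x\<in>Pts m. f x \<and> j \<in> x) (\<lambda>x\<in>Pts m. f x \<and> aff a b x)"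
      unfolding fadd_def by (intro restrict_ext) auto
    then show ?case
      by (simp only:) (rule RM_fadd[OF RM_mult_var[OF f] insert.IH]; use insert.prems in auto)
  qed
qed

lemma Tgen_subset_RM: "Tgen m d \<subseteq> RM m d"
proof
  fix h assume "h \<in> Tgen m d"
  then obtain a b where ab: "h = (\<lambda>x\<in>Pts m. \<forall>i<d. aff (a i) (b i) x)" "\<And>i. i < d \<Longrightarrow> a i \<subseteq> {..<m}"
    by (auto simp: Tgen_def)
  have "(\<lambda>x\<in>Pts m. \<forall>i<e. aff (a i) (b i) x) \<in> RM m e" if "e \<le> d" for e
    using that
  proof (induction e)
    case 0
    have "(\<lambda>x\<in>Pts m. \<forall>i<0. aff (a i) (b i) x) = (\<lambda>x\<in>Pts m. {} \<subseteq> x)" by auto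
    then show ?case by (simp only:) (rule RM_monomial; simp)
  next
    case (Suc e)
    have "(\<lambda>x\<in>Pts m. \<forall>i<Suc e. aff (a i) (b i) x)
       = (\<lambda>x\<in>Pts m. (\<lambda>x\<in>Pts m. \<forall>i<e. aff (a i) (b i) x) x \<and> aff (a e) (b e) x)"
      by (intro restrict_ext) (auto simp: less_Suc_eq)
    then show ?case
      by (simp only:) (rule RM_mult_aff[OF Suc.IH]; use ab(2)[of e] Suc.prems in simp)
  qed
  then show "h \<in> RM m d" using ab by simp
qed

section \<open>Duality, dual distance and size of the code\<close>

lemma chi_fadd:
  assumes "A \<subseteq> Pts m"
  shows "chi A (fadd m f g) = chi A f * chi A g"
proof -
  have "chi A (fadd m f g) = chi A (\<lambda>x. f x \<noteq> g x)"
    using assms by (intro chi_cong) (auto simp: fadd_def)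
  then show ?thesis by (simp only: chi_neq)
qed

lemma fadd_cancel: "g \<in> extensional (Pts m) \<Longrightarrow> fadd m f (fadd m f g) = g"
  by (auto simp: fadd_def fun_eq_iff extensional_def)

lemma fadd_commute: "fadd m f g = fadd m g f"
  by (auto simp: fadd_def)

text \<open>Some coordinate j < m outside S is free, and flipping it pairs up the points.\<close>

lemma even_card_superset:
  assumes S: "card S < m"
  shows "even (card {x\<in>Pts m. S \<subseteq> x})"
proof (cases "S \<subseteq> {..<m}")
  case False
  then have "{x\<in>Pts m. S \<subseteq> x} = {}" by (auto simp: Pts_def)
  then show ?thesis by (simp only: card.empty) simp
next
  case True
  have "S \<noteq> {..<m}" using S by auto
  then obtain j where j: "j < m" "j \<notin> S" using True by blast
  let ?X = "{x\<in>Pts m. S \<subseteq> x \<and> j \<in> x}" and ?Y = "{x\<in>Pts m. S \<subseteq> x \<and> j \<notin> x}"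
  have "bij_betw (\<lambda>x. x - {j}) ?X ?Y"
    by (rule bij_betw_byWitness[of _ "insert j"]) (use j in \<open>auto simp: Pts_def\<close>)
  then have "card ?X = card ?Y" by (rule bij_betw_same_card)
  moreover have "card {x\<in>Pts m. S \<subseteq> x} = card ?X + card ?Y"
    by (subst card_Un_disjoint[symmetric]) (auto intro!: arg_cong[where f=card])
  ultimately show ?thesis by simp
qed

text \<open>A product of two codewords has degree below m, hence even weight. Additivity in both
  arguments reduces this to two monomials, whose product is the monomial S \<union> S'.\<close>

lemma RM_orthogonal:
  assumes f: "f \<in> RM m d" and g: "g \<in> RM m e" and de: "d + e < m"
  shows "chi {x\<in>Pts m. g x} f = 1"
  using g
proof (induction rule: RM_induct)
  case zero
  have "{x\<in>Pts m. (\<lambda>x\<in>Pts m. False) x} = {}" by auto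
  then show ?case by simp
next
  case (add S g)
  have mono: "chi {x\<in>Pts m. S \<subseteq> x} f = 1"
    using f
  proof (induction rule: RM_induct)
    case zero
    show ?case by (simp add: chi_def)
  next
    case (add S' f)
    have "card (S \<union> S') \<le> e + d" using card_Un_le[of S S'] add \<open>card S \<le> e\<close> by simp
    then have "even (card {x\<in>Pts m. S \<union> S' \<subseteq> x})" using de by (intro even_card_superset) simp
    moreover have "{x\<in>{x\<in>Pts m. S \<subseteq> x}. (\<lambda>x\<in>Pts m. S' \<subseteq> x) x} = {x\<in>Pts m. S \<union> S' \<subseteq> x}" by auto
    ultimately have "chi {x\<in>Pts m. S \<subseteq> x} (\<lambda>x\<in>Pts m. S' \<subseteq> x) = 1"
      by (subst chi_parity) simp_all
    then show ?case using add by (subst chi_fadd) auto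
  qed
  have "{x\<in>Pts m. fadd m (\<lambda>x\<in>Pts m. S \<subseteq> x) g x} = sym_diff {x\<in>Pts m. S \<subseteq> x} {x\<in>Pts m. g x}"
    by (auto simp: fadd_def)
  then show ?case using mono add.IH by (simp only: chi_sym_diff finite_Pts finite_Collect_conjI) (simp add: chi_sym_diff)
qed

text \<open>The dual distance is at least 2^(d+1). Induction on m splits B by its last coordinate
  into B0 and B1. A monomial without m counts on both halves, one with m on B1 alone, and one of two
  nonempty halves has fewer than 2^d points.\<close>

lemma odd_monomial_exists:
  assumes "B \<subseteq> Pts m" "B \<noteq> {}" "card B < 2 ^ Suc d"
  shows "\<exists>S\<subseteq>{..<m}. card S \<le> d \<and> odd (card {x\<in>B. S \<subseteq> x})"
  using assms
proof (induction m arbitrary: B d)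
  case 0
  then have "B = {{}}" by (auto simp: Pts_def)
  then have "{x\<in>B. {} \<subseteq> x} = {{}}" by auto
  then show ?case by (intro exI[of _ "{}"]) simp
next
  case (Suc m)
  define B0 where "B0 = {x\<in>B. m \<notin> x}"
  define B1 where "B1 = (\<lambda>x. x - {m}) ` {x\<in>B. m \<in> x}"
  have finB: "finite B" using Suc.prems(1) finite_Pts finite_subset by blast
  have inj: "inj_on (\<lambda>x. x - {m}) {x\<in>B. m \<in> x}" by (rule inj_onI) auto
  have sub: "B0 \<subseteq> Pts m" "B1 \<subseteq> Pts m"
    using Suc.prems(1) by (auto simp: B0_def B1_def Pts_def less_Suc_eq subset_iff)
  have n1: "card {x\<in>B. insert m S \<subseteq> x} = card {x\<in>B1. S \<subseteq> x}" if "S \<subseteq> {..<m}" for S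
  proof -
    have "{x\<in>B1. S \<subseteq> x} = (\<lambda>x. x - {m}) ` {x\<in>B. insert m S \<subseteq> x}"
      using that by (auto simp: B1_def)
    then show ?thesis using inj by (auto intro!: card_image[symmetric] elim: inj_on_subset)
  qed
  have n0: "card {x\<in>B. S \<subseteq> x} = card {x\<in>B0. S \<subseteq> x} + card {x\<in>B1. S \<subseteq> x}" if "S \<subseteq> {..<m}" for S
  proof -
    have "card {x\<in>B. S \<subseteq> x} = card {x\<in>B0. S \<subseteq> x} + card {x\<in>B. insert m S \<subseteq> x}"
      using finB by (subst card_Un_disjoint[symmetric]) (auto simp: B0_def intro!: arg_cong[where f=card])
    then show ?thesis using n1[OF that] by simp
  qed
  have cB: "card B = card B0 + card B1" using n0[of "{}"] by simp
  have ins: "insert m S \<subseteq> {..<Suc m}" "S \<subseteq> {..<Suc m}" "card (insert m S) \<le> Suc (card S)"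
    if "S \<subseteq> {..<m}" for S using that card_insert_le_m1[of "Suc (card S)" S m] by auto
  consider "B1 = {}" | "B0 = {}" | "B0 \<noteq> {}" "B1 \<noteq> {}" by blast
  then show ?case
  proof cases
    case 1
    then have "B0 \<noteq> {}" using Suc.prems(2) by (auto simp: B0_def B1_def)
    moreover have "card B0 < 2 ^ Suc d" using Suc.prems(3) cB by simp
    ultimately obtain S where S: "S \<subseteq> {..<m}" "card S \<le> d" "odd (card {x\<in>B0. S \<subseteq> x})"
      using Suc.IH[OF sub(1)] by blast
    then have "odd (card {x\<in>B. S \<subseteq> x})" using n0[OF S(1)] 1 by simp
    then show ?thesis using S(2) ins(2)[OF S(1)] by blast
  next
    case 2
    then have "B1 \<noteq> {}" using Suc.prems(2) by (auto simp: B0_def B1_def)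
    moreover have "card B1 < 2 ^ Suc d" using Suc.prems(3) cB by simp
    ultimately obtain S where S: "S \<subseteq> {..<m}" "card S \<le> d" "odd (card {x\<in>B1. S \<subseteq> x})"
      using Suc.IH[OF sub(2)] by blast
    then have "odd (card {x\<in>B. S \<subseteq> x})" using n0[OF S(1)] 2 by simp
    then show ?thesis using S(2) ins(2)[OF S(1)] by blast
  next
    case 3
    have fin: "finite B0" "finite B1" using finB by (auto simp: B0_def B1_def)
    then have "card B0 > 0" "card B1 > 0" using 3 by (auto simp: card_gt_0_iff)
    \<comment> \<open>Two nonempty halves give B at least two points, which excludes d = 0.\<close>
    then obtain e where d: "d = Suc e" using cB Suc.prems(3) by (cases d) auto
    show ?thesis
    proof (cases "card B1 < 2 ^ Suc e")
      case True
      then obtain S where S: "S \<subseteq> {..<m}" "card S \<le> e" "odd (card {x\<in>B1. S \<subseteq> x})"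
        using Suc.IH[OF sub(2) 3(2)] by blast
      then show ?thesis using n1[of S] ins[of S] d by (intro exI[of _ "insert m S"]) auto
    next
      case False
      then have "card B0 < 2 ^ Suc e" using cB Suc.prems(3) d by simp
      then obtain S where S: "S \<subseteq> {..<m}" "card S \<le> e" "odd (card {x\<in>B0. S \<subseteq> x})"
        using Suc.IH[OF sub(1) 3(1)] by blast
      show ?thesis
      \<comment> \<open>S is odd on B0. If it is odd on B1 as well, the parities cancel on B, but
        adding m isolates B1.\<close>
      proof (cases "odd (card {x\<in>B1. S \<subseteq> x})")
        case True
        then show ?thesis using S n1[of S] ins[of S] d by (intro exI[of _ "insert m S"]) auto
      next
        case False
        then show ?thesis using S n0[of S] ins[of S] d by (intro exI[of _ S]) auto
      qed
    qed
  qed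
qed

lemma sum_RM_chi_translate:
  assumes A: "A \<subseteq> Pts m" and f0: "f0 \<in> RM m d" "chi A f0 \<noteq> 1"
  shows "(\<Sum>f\<in>RM m d. chi A f) = 0"
proof -
  have "(\<Sum>f\<in>RM m d. chi A f) = (\<Sum>f\<in>RM m d. chi A (fadd m f0 f))"
    by (rule sum.reindex_bij_witness[of _ "fadd m f0" "fadd m f0"])
       (use f0 RM_fadd fadd_cancel RM_extensional in auto)
  also have "\<dots> = chi A f0 * (\<Sum>f\<in>RM m d. chi A f)"
    using A by (simp add: chi_fadd sum_distrib_left)
  finally show ?thesis using f0(2) by simp
qed

text \<open>Any 2^(d+1) - 1 coordinates of a uniform codeword are independent: translating by a
  codeword that is odd on B negates the sum.\<close>

lemma sum_RM_chi_zero: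
  assumes B: "B \<subseteq> Pts m" "B \<noteq> {}" "card B < 2 ^ Suc d"
  shows "(\<Sum>f\<in>RM m d. chi B f) = 0"
proof -
  obtain S where S: "S \<subseteq> {..<m}" "card S \<le> d" "odd (card {x\<in>B. S \<subseteq> x})"
    using odd_monomial_exists[OF assms] by blast
  have "{x\<in>B. (\<lambda>x\<in>Pts m. S \<subseteq> x) x} = {x\<in>B. S \<subseteq> x}" using B by auto
  then have "chi B (\<lambda>x\<in>Pts m. S \<subseteq> x) = -1"
    using S finite_subset[OF B(1)] by (subst chi_parity) simp_all
  then show ?thesis using sum_RM_chi_translate[OF B(1) RM_monomial[OF S(1,2)]] by simp
qed

text \<open>Complementation maps the monomials of degree at most m-d-1 injectively to those of
  degree above d, so the two families together have at most 2^m members.\<close>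

lemma card_RM_dual_le:
  assumes "d < m"
  shows "card (RM m d) * card (RM m (m - d - 1)) \<le> 2 ^ 2 ^ m"
proof -
  have "(\<lambda>S. {..<m} - S) ` monoms m (m - d - 1) \<subseteq> Pts m - monoms m d"
    using assms by (auto simp: monoms_def Pts_def card_Diff_subset finite_subset[of _ "{..<m}"])
  then have "card (monoms m (m - d - 1)) \<le> card (Pts m - monoms m d)"
    by (intro card_inj_on_le[of "\<lambda>S. {..<m} - S"]) (auto simp: monoms_def intro!: inj_onI)
  also have "\<dots> = 2 ^ m - card (monoms m d)"
    by (subst card_Diff_subset) (auto simp: card_Pow monoms_def Pts_def intro: finite_subset[of _ "Pow {..<m}"])
  finally have "card (monoms m (m - d - 1)) \<le> 2 ^ m - card (monoms m d)" .
  moreover have "card (monoms m d) \<le> 2 ^ m"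
    unfolding card_Pts[symmetric] by (intro card_mono) (auto simp: monoms_def Pts_def)
  ultimately have "card (monoms m d) + card (monoms m (m - d - 1)) \<le> 2 ^ m" by linarith
  then have "(2::nat) ^ card (monoms m d) * 2 ^ card (monoms m (m - d - 1)) \<le> 2 ^ 2 ^ m"
    unfolding power_add[symmetric] by (intro power_increasing) auto
  then show ?thesis using mult_mono[OF card_RM_le card_RM_le, of m d m "m - d - 1"] by linarith
qed

lemma card_monoms_le: "card (monoms m d) \<le> (m + 1) ^ d"
proof -
  define g where "g = (\<lambda>F::nat \<Rightarrow> nat. {i. i < m \<and> i \<in> F ` {..<d}})"
  have "S \<in> g ` (Pi\<^sub>E {..<d} (\<lambda>_. {..m}))" if S: "S \<in> monoms m d" for S
  proof -
    have Sm: "S \<subseteq> {..<m}" "card S \<le> d" "finite S"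
      using S by (auto simp: monoms_def intro: finite_subset)
    obtain e where e: "bij_betw e {..<card S} S"
      using ex_bij_betw_nat_finite[OF Sm(3)] by (auto simp: lessThan_atLeast0)
    \<comment> \<open>A monomial with fewer than d variables is padded with the value m, which
      \<open>g\<close> discards.\<close>
    define F where "F = (\<lambda>i\<in>{..<d}. if i < card S then e i else m)"
    have im: "e ` {..<card S} = S" using e by (simp add: bij_betw_def)
    have "e j < m" if "j < card S" for j using im Sm that by blast
    then have "F \<in> Pi\<^sub>E {..<d} (\<lambda>_. {..m})" by (auto simp: F_def less_imp_le)
    moreover have "g F = S"
    proof (intro set_eqI iffI)
      fix i assume "i \<in> S"
      then obtain j where "j < card S" "i = e j" using im by auto
      then show "i \<in> g F" using Sm \<open>i \<in> S\<close> unfolding g_def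
        by (auto simp: F_def intro!: image_eqI[of _ _ j])
    next
      fix i assume "i \<in> g F"
      then show "i \<in> S" using im by (auto simp: g_def F_def split: if_splits)
    qed
    ultimately show ?thesis by blast
  qed
  then have "card (monoms m d) \<le> card (Pi\<^sub>E {..<d} (\<lambda>_. {..m}))"
    by (intro surj_card_le[of _ _ g] finite_PiE) auto
  then show ?thesis by (simp add: card_PiE)
qed

section \<open>Spectrum and the semidefinite program\<close>

definition eigG :: "nat \<Rightarrow> nat \<Rightarrow> nat set set \<Rightarrow> real" where
  "eigG m d A = (\<Sum>h\<in>Tgen m d. chi A h) / card (Tgen m d)"

definition eigM :: "nat \<Rightarrow> nat \<Rightarrow> real \<Rightarrow> nat set set \<Rightarrow> real" where
  "eigM m d t A = - t * (1 - eigG m d A)"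

lemma Gmat_eigenvector:
  assumes A: "A \<subseteq> Pts m" and g: "g \<in> RM m d"
  shows "(\<Sum>l\<in>RM m d. chi A l * Gmat m d l g) = eigG m d A * chi A g"
proof -
  have G: "Gmat m d l g = (\<Sum>h\<in>Tgen m d. of_bool (fadd m l h = g)) / card (Tgen m d)" for l
    by (simp add: Gmat_def finite_Tgen of_bool_def sum.If_cases Int_def)
  have inner: "(\<Sum>l\<in>RM m d. chi A l * of_bool (fadd m l h = g)) = chi A g * chi A h"
    if h: "h \<in> Tgen m d" for h
  proof -
    have hR: "h \<in> RM m d" using h Tgen_subset_RM by blast
    have gh: "fadd m g h \<in> RM m d" using RM_fadd[OF g hR] .
    have "fadd m l h = g \<longleftrightarrow> l = fadd m g h" if "l \<in> RM m d" for l
      using fadd_cancel[OF RM_extensional[OF that], of h] fadd_cancel[OF RM_extensional[OF g], of h]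
      by (metis fadd_commute)
    then have "(\<Sum>l\<in>RM m d. chi A l * of_bool (fadd m l h = g))
        = (\<Sum>l\<in>RM m d. if l = fadd m g h then chi A l else 0)"
      by (intro sum.cong) auto
    also have "\<dots> = chi A (fadd m g h)" using gh by (simp add: sum.delta')
    finally show ?thesis using chi_fadd[OF A] by simp
  qed
  have "(\<Sum>l\<in>RM m d. chi A l * Gmat m d l g)
      = (\<Sum>l\<in>RM m d. \<Sum>h\<in>Tgen m d. chi A l * of_bool (fadd m l h = g)) / card (Tgen m d)"
    unfolding G by (simp add: sum_distrib_left sum_divide_distrib)
  also have "\<dots> = (\<Sum>h\<in>Tgen m d. chi A g * chi A h) / card (Tgen m d)"
    by (subst sum.swap, intro arg_cong[where f="\<lambda>x. x / _"] sum.cong refl inner)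
  finally show ?thesis unfolding eigG_def sum_distrib_left[symmetric] by (simp add: mult.commute)
qed

lemma laplacian_eigenvector:
  assumes A: "A \<subseteq> Pts m" and g: "g \<in> RM m d"
  shows "(\<Sum>l\<in>RM m d. chi A l * (- t * ((if l = g then 1 else 0) - Gmat m d l g))) = eigM m d t A * chi A g"
proof -
  have "(\<Sum>l\<in>RM m d. chi A l * (- t * ((if l = g then 1 else 0) - Gmat m d l g)))
      = (\<Sum>l\<in>RM m d. - t * (if l = g then chi A l else 0) + t * (chi A l * Gmat m d l g))"
    by (intro sum.cong) (auto simp: algebra_simps)
  also have "\<dots> = - t * (\<Sum>l\<in>RM m d. if l = g then chi A l else 0) + t * (\<Sum>l\<in>RM m d. chi A l * Gmat m d l g)"
    by (simp only: sum.distrib sum_distrib_left)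
  finally show ?thesis
    using g by (simp add: Gmat_eigenvector[OF A g] sum.delta' eigM_def algebra_simps)
qed

text \<open>The tight frame identity: all 2^(2^m) characters together resolve the identity on the
  code, up to this constant.\<close>

lemma sum_chi_chi:
  assumes "f \<in> RM m d" "g \<in> RM m d"
  shows "(\<Sum>A\<in>Pow (Pts m). chi A f * chi A g) = (if f = g then 2 ^ 2 ^ m else 0)"
proof -
  have "f = g \<longleftrightarrow> (\<forall>x\<in>Pts m. f x = g x)"
    using extensionalityI[OF RM_extensional[OF assms(1)] RM_extensional[OF assms(2)]] by auto
  then show ?thesis
    unfolding chi_neq[symmetric] by (subst sum_Pow_chi) (auto simp: card_Pts)
qed

text \<open>Power 0 is the frame identity, and each further factor acts on the characters by their
  eigenvalue.\<close>

lemma mpow_spectral: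
  assumes f: "f \<in> RM m d" and g: "g \<in> RM m d"
  shows "mpow (RM m d) (\<lambda>f g. - t * ((if f = g then 1 else 0) - Gmat m d f g)) p f g
    = (\<Sum>A\<in>Pow (Pts m). eigM m d t A ^ p * (chi A f * chi A g)) / 2 ^ 2 ^ m"
  using g
proof (induction p arbitrary: g)
  case 0
  then show ?case using sum_chi_chi[OF f] by simp
next
  case (Suc p)
  define M where "M = (\<lambda>f g. - t * ((if f = g then 1 else 0) - Gmat m d f g))"
  have "mpow (RM m d) M (Suc p) f g
      = (\<Sum>l\<in>RM m d. (\<Sum>A\<in>Pow (Pts m). eigM m d t A ^ p * (chi A f * chi A l)) / 2 ^ 2 ^ m * M l g)"
    using Suc.IH by (simp add: mmul_def M_def)
  also have "\<dots> = (\<Sum>l\<in>RM m d. \<Sum>A\<in>Pow (Pts m). eigM m d t A ^ p * chi A f * (chi A l * M l g)) / 2 ^ 2 ^ m"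
    by (simp add: sum_divide_distrib sum_distrib_left sum_distrib_right mult_ac)
  also have "\<dots> = (\<Sum>A\<in>Pow (Pts m). eigM m d t A ^ p * chi A f * (\<Sum>l\<in>RM m d. chi A l * M l g)) / 2 ^ 2 ^ m"
    by (subst sum.swap) (simp add: sum_distrib_left)
  also have "\<dots> = (\<Sum>A\<in>Pow (Pts m). eigM m d t A ^ Suc p * (chi A f * chi A g)) / 2 ^ 2 ^ m"
    unfolding M_def using laplacian_eigenvector[OF _ Suc.prems]
    by (intro arg_cong[where f="\<lambda>x. x / 2 ^ 2 ^ m"] sum.cong refl) (simp only: Pow_iff, simp add: mult_ac)
  finally show ?case unfolding M_def .
qed

text \<open>\<open>mexp\<close> is a bare infinite sum, so convergence is established along with the
  closed form.\<close>

lemma mpow_sums_Amat: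
  assumes f: "f \<in> RM m d" and g: "g \<in> RM m d"
  shows "(\<lambda>p. mpow (RM m d) (\<lambda>f g. - t * ((if f = g then 1 else 0) - Gmat m d f g)) p f g / fact p)
      sums Amat m d t f g" (is ?sums)
    and Amat_spectral: "Amat m d t f g
      = (\<Sum>A\<in>Pow (Pts m). exp (eigM m d t A) * (chi A f * chi A g)) / 2 ^ 2 ^ m" (is ?eq)
proof -
  have "(\<lambda>p. eigM m d t A ^ p / fact p * (chi A f * chi A g)) sums (exp (eigM m d t A) * (chi A f * chi A g))" for A
    using exp_converges[of "eigM m d t A"] by (intro sums_mult2) (simp add: divide_inverse mult.commute)
  then have "(\<lambda>p. (\<Sum>A\<in>Pow (Pts m). eigM m d t A ^ p / fact p * (chi A f * chi A g)) / 2 ^ 2 ^ m)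
     sums ((\<Sum>A\<in>Pow (Pts m). exp (eigM m d t A) * (chi A f * chi A g)) / 2 ^ 2 ^ m)"
    by (intro sums_divide sums_sum)
  then have S: "(\<lambda>p. mpow (RM m d) (\<lambda>f g. - t * ((if f = g then 1 else 0) - Gmat m d f g)) p f g / fact p)
     sums ((\<Sum>A\<in>Pow (Pts m). exp (eigM m d t A) * (chi A f * chi A g)) / 2 ^ 2 ^ m)"
    unfolding mpow_spectral[OF f g] by (simp add: sum_divide_distrib mult_ac)
  then show ?sums unfolding Amat_def mexp_def by (rule sums_summable[THEN summable_sums])
  with S show ?eq using sums_unique2 by blast
qed

lemma Amat_quadratic_form:
  "(\<Sum>f\<in>RM m d. \<Sum>g\<in>RM m d. x f * Amat m d t f g * x g)
    = (\<Sum>A\<in>Pow (Pts m). exp (eigM m d t A) * (\<Sum>f\<in>RM m d. x f * chi A f)\<^sup>2) / 2 ^ 2 ^ m"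
proof -
  have "(\<Sum>f\<in>RM m d. \<Sum>g\<in>RM m d. x f * Amat m d t f g * x g)
     = (\<Sum>f\<in>RM m d. \<Sum>g\<in>RM m d. \<Sum>A\<in>Pow (Pts m). exp (eigM m d t A) * ((x f * chi A f) * (x g * chi A g))) / 2 ^ 2 ^ m"
    by (simp add: Amat_spectral sum_divide_distrib sum_distrib_left sum_distrib_right mult_ac)
  also have "\<dots> = (\<Sum>A\<in>Pow (Pts m). \<Sum>f\<in>RM m d. \<Sum>g\<in>RM m d. exp (eigM m d t A) * ((x f * chi A f) * (x g * chi A g))) / 2 ^ 2 ^ m"
    by (simp only: sum.swap[of _ _ "Pow (Pts m)"])
  finally show ?thesis
    by (simp only: power2_eq_square sum_product) (simp only: sum_distrib_left)
qed

lemma parseval: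
  "(\<Sum>A\<in>Pow (Pts m). (\<Sum>f\<in>RM m d. x f * chi A f)\<^sup>2) = 2 ^ 2 ^ m * (\<Sum>f\<in>RM m d. (x f)\<^sup>2)"
proof -
  have "(\<Sum>A\<in>Pow (Pts m). (\<Sum>f\<in>RM m d. x f * chi A f)\<^sup>2)
     = (\<Sum>A\<in>Pow (Pts m). \<Sum>f\<in>RM m d. \<Sum>g\<in>RM m d. x f * x g * (chi A f * chi A g))"
    by (simp add: power2_eq_square sum_product mult_ac)
  also have "\<dots> = (\<Sum>f\<in>RM m d. \<Sum>g\<in>RM m d. \<Sum>A\<in>Pow (Pts m). x f * x g * (chi A f * chi A g))"
    by (simp only: sum.swap[of _ _ "Pow (Pts m)"])
  also have "\<dots> = (\<Sum>f\<in>RM m d. \<Sum>g\<in>RM m d. x f * x g * (if f = g then 2 ^ 2 ^ m else 0))"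
    by (simp add: sum_distrib_left[symmetric] sum_chi_chi)
  also have "\<dots> = (\<Sum>f\<in>RM m d. \<Sum>g\<in>RM m d. if f = g then x f * x g * 2 ^ 2 ^ m else 0)"
    by (intro sum.cong refl) auto
  also have "\<dots> = (\<Sum>f\<in>RM m d. x f * x f * 2 ^ 2 ^ m)" by simp
  finally show ?thesis by (simp add: power2_eq_square sum_distrib_left mult_ac)
qed

text \<open>Derived from the powers rather than from \<open>Amat_spectral\<close>: there, every B
  whose character agrees with that of A on the code contributes, and these would have to be
  counted.\<close>

lemma Amat_eigenvector:
  assumes A: "A \<subseteq> Pts m" and g: "g \<in> RM m d"
  shows "(\<Sum>f\<in>RM m d. chi A f * Amat m d t f g) = exp (eigM m d t A) * chi A g"
proof -
  define M where "M = (\<lambda>f g. - t * ((if f = g then 1 else 0) - Gmat m d f g))"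
  have pow: "(\<Sum>f\<in>RM m d. chi A f * mpow (RM m d) M p f g) = eigM m d t A ^ p * chi A g" for p
    using g
  proof (induction p arbitrary: g)
    case 0
    then show ?case by (simp add: if_distrib[where f="\<lambda>x. _ * x"] cong: if_cong)
  next
    case (Suc p)
    have "(\<Sum>f\<in>RM m d. chi A f * mpow (RM m d) M (Suc p) f g)
        = (\<Sum>f\<in>RM m d. \<Sum>l\<in>RM m d. chi A f * mpow (RM m d) M p f l * M l g)"
      by (simp add: mmul_def sum_distrib_left mult.assoc)
    also have "\<dots> = (\<Sum>l\<in>RM m d. (\<Sum>f\<in>RM m d. chi A f * mpow (RM m d) M p f l) * M l g)"
      by (subst sum.swap) (simp add: sum_distrib_right)
    also have "\<dots> = eigM m d t A ^ p * (\<Sum>l\<in>RM m d. chi A l * M l g)"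
      using Suc.IH by (simp add: sum_distrib_left mult.assoc)
    finally show ?case using laplacian_eigenvector[OF A Suc.prems, of t] by (simp add: M_def mult_ac)
  qed
  have "(\<lambda>p. \<Sum>f\<in>RM m d. chi A f * (mpow (RM m d) M p f g / fact p)) sums (\<Sum>f\<in>RM m d. chi A f * Amat m d t f g)"
    unfolding M_def using mpow_sums_Amat g by (intro sums_sum sums_mult) auto
  also have "(\<lambda>p. \<Sum>f\<in>RM m d. chi A f * (mpow (RM m d) M p f g / fact p)) = (\<lambda>p. eigM m d t A ^ p / fact p * chi A g)"
    by (simp add: pow sum_divide_distrib[symmetric] fun_eq_iff)
  finally have "(\<lambda>p. eigM m d t A ^ p / fact p * chi A g) sums (\<Sum>f\<in>RM m d. chi A f * Amat m d t f g)" .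
  moreover have "(\<lambda>p. eigM m d t A ^ p / fact p * chi A g) sums (exp (eigM m d t A) * chi A g)"
    using exp_converges[of "eigM m d t A"] by (intro sums_mult2) (simp add: divide_inverse mult.commute)
  ultimately show ?thesis using sums_unique2 by blast
qed

section \<open>The dictators and the semidefinite solution\<close>

lemma card_Tgen_pos:
  assumes "d \<le> m"
  shows "card (Tgen m d) > 0"
proof -
  \<comment> \<open>The witness is the space of vectors supported on the first m-d
    coordinates.\<close>
  have "subsp m (Pts (m - d))"
    unfolding subsp_def using xorset_Pts[of _ "m - d"] by (auto simp: Pts_def)
  moreover have "{} \<in> Pts m" by (simp add: Pts_def)
  ultimately have "coset_ind m (Pts (m - d)) {} \<in> Tgen m d"
    using assms by (intro coset_ind_in_Tgen) (auto simp: card_Pts)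
  then show ?thesis using finite_Tgen card_gt_0_iff by blast
qed

lemma eigM_eq:
  assumes A: "A \<subseteq> Pts m" and d: "d \<le> m"
  shows "eigM m d t A = - 2 * t * (card {h\<in>Tgen m d. odd (card {x\<in>A. h x})} / card (Tgen m d))"
proof -
  have finA: "finite A" using finite_subset[OF A] by simp
  have "(\<Sum>h\<in>Tgen m d. chi A h) = (\<Sum>h\<in>Tgen m d. 1 - 2 * of_bool (odd (card {x\<in>A. h x})))"
    using finA by (intro sum.cong) (auto simp: chi_parity)
  also have "\<dots> = real (card (Tgen m d)) - 2 * real (card {h\<in>Tgen m d. odd (card {x\<in>A. h x})})"
    using finite_Tgen[of m d]
    by (simp add: sum_subtractf sum_distrib_left[symmetric] of_bool_def sum.If_cases Int_def del: odd_card_imp_not_empty)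
  finally show ?thesis
    using card_Tgen_pos[OF d] unfolding eigM_def eigG_def by (simp only:) (simp add: field_simps)
qed

text \<open>Each generator contains 2^(m-d) points, and t = 2^(d-1) normalises the average exponent
  of a dictator to -1.\<close>

lemma sum_eigM_singletons:
  assumes d: "d \<le> m" and t: "t = 2 powr (real d - 1)"
  shows "(\<Sum>p\<in>Pts m. eigM m d t {p}) = - (2 ^ m)"
proof -
  have e: "eigM m d t {p} = - 2 * t / card (Tgen m d) * (\<Sum>h\<in>Tgen m d. of_bool (h p))" if "p \<in> Pts m" for p
  proof -
    have "{x\<in>{p}. h x} = (if h p then {p} else {})" for h by auto
    then have "odd (card {x\<in>{p}. h x}) \<longleftrightarrow> h p" for h by simp
    then have "eigM m d t {p} = - 2 * t * (card {h\<in>Tgen m d. h p} / card (Tgen m d))"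
      using eigM_eq[of "{p}" m d t] that d by simp
    then show ?thesis using finite_Tgen[of m d] by (simp add: of_bool_def sum.If_cases Int_def)
  qed
  have "(\<Sum>p\<in>Pts m. eigM m d t {p})
      = (\<Sum>p\<in>Pts m. - 2 * t / card (Tgen m d) * (\<Sum>h\<in>Tgen m d. of_bool (h p)))"
    by (intro sum.cong refl e)
  also have "\<dots> = - 2 * t / card (Tgen m d) * (\<Sum>h\<in>Tgen m d. \<Sum>p\<in>Pts m. of_bool (h p))"
    by (subst sum.swap) (simp only: sum_distrib_left)
  also have "(\<Sum>h\<in>Tgen m d. \<Sum>p\<in>Pts m. of_bool (h p) :: real) = (\<Sum>h\<in>Tgen m d. 2 ^ (m - d))"
  proof (rule sum.cong[OF refl])
    fix h assume "h \<in> Tgen m d"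
    from card_Tgen_support[OF this d] show "(\<Sum>p\<in>Pts m. of_bool (h p) :: real) = 2 ^ (m - d)"
      by (simp add: of_bool_def sum.If_cases Int_def)
  qed
  also have "- 2 * t / card (Tgen m d) * \<dots> = - (2 * t * 2 ^ (m - d))"
    using card_Tgen_pos[OF d] by simp
  also have "2 * t = 2 ^ d" by (simp add: t powr_diff powr_realpow)
  finally show ?thesis using d by (simp flip: power_add)
qed

text \<open>Each of the 2^m rank-one terms has trace \<open>card (RM m d)\<close>, whence the
  normalisation.\<close>

definition dictX :: "nat \<Rightarrow> nat \<Rightarrow> (nat set \<Rightarrow> bool) \<Rightarrow> (nat set \<Rightarrow> bool) \<Rightarrow> real" where
  "dictX m d f g = (\<Sum>p\<in>Pts m. chi {p} f * chi {p} g) / (card (RM m d) * 2 ^ m)"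

lemma card_RM_pos: "card (RM m d) > 0"
  by (metis RM_zero card_gt_0_iff empty_iff finite_RM)

lemma psd_dictX: "psd (RM m d) (dictX m d)"
  unfolding psd_def
proof (intro conjI ballI allI)
  show "dictX m d f g = dictX m d g f" for f g by (simp add: dictX_def mult.commute)
  fix x :: "(nat set \<Rightarrow> bool) \<Rightarrow> real"
  have "(\<Sum>f\<in>RM m d. \<Sum>g\<in>RM m d. x f * dictX m d f g * x g)
      = (\<Sum>f\<in>RM m d. \<Sum>g\<in>RM m d. \<Sum>p\<in>Pts m. (x f * chi {p} f) * (x g * chi {p} g)) / (card (RM m d) * 2 ^ m)"
    unfolding dictX_def by (simp add: sum_divide_distrib sum_distrib_left sum_distrib_right mult_ac del: chi_singleton)
  also have "\<dots> = (\<Sum>p\<in>Pts m. (\<Sum>f\<in>RM m d. x f * chi {p} f)\<^sup>2) / (card (RM m d) * 2 ^ m)"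
    by (simp add: sum.swap[of _ _ "Pts m"] power2_eq_square sum_product del: chi_singleton)
  also have "\<dots> \<ge> 0" by (intro divide_nonneg_nonneg sum_nonneg) auto
  finally show "(\<Sum>f\<in>RM m d. \<Sum>g\<in>RM m d. x f * dictX m d f g * x g) \<ge> 0" .
qed

lemma trace_dictX: "mtrace (RM m d) (dictX m d) = 1"
  using card_RM_pos[of m d] unfolding mtrace_def dictX_def by (auto simp: card_Pts card_gt_0_iff simp del: chi_singleton)

text \<open>Orthogonality of the dictators gives squared Frobenius norm 2^(-m). Cauchy-Schwarz over
  the n^2 entries turns this into n / 2^(m/2), which is exactly k.\<close>

lemma sum_abs_dictX:
  assumes d: "d \<ge> 1"
  shows "(\<Sum>f\<in>RM m d. \<Sum>g\<in>RM m d. \<bar>dictX m d f g\<bar>) \<le> card (RM m d) / 2 powr (m / 2)"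
proof -
  define n where "n = real (card (RM m d))"
  have n: "n > 0" unfolding n_def using card_RM_pos by simp
  let ?VV = "RM m d \<times> RM m d"
  have pq: "(\<Sum>f\<in>RM m d. chi {p} f * chi {q} f) = (if p = q then n else 0)"
    if "p \<in> Pts m" "q \<in> Pts m" for p q
  proof (cases "p = q")
    case False
    \<comment> \<open>Pairwise independence: d >= 1 puts two points below the dual distance 4 or
      more.\<close>
    have "(2::nat) ^ Suc 1 \<le> 2 ^ Suc d" using d by (intro power_increasing) auto
    then have "(\<Sum>f\<in>RM m d. chi {p, q} f) = 0"
      using that False by (intro sum_RM_chi_zero) auto
    then show ?thesis using False by (simp add: chi_insert)
  qed (simp add: n_def del: chi_singleton)
  have sq: "(\<Sum>(f, g)\<in>?VV. (dictX m d f g)\<^sup>2) = 1 / 2 ^ m"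
  proof -
    have "(\<Sum>(f, g)\<in>?VV. (dictX m d f g)\<^sup>2)
      = (\<Sum>f\<in>RM m d. \<Sum>g\<in>RM m d. (\<Sum>p\<in>Pts m. chi {p} f * chi {p} g)\<^sup>2) / (n * 2 ^ m)\<^sup>2"
      by (simp only: dictX_def n_def sum.cartesian_product[symmetric] power_divide of_nat_mult of_nat_power of_nat_numeral) (simp only: sum_divide_distrib)
    also have "(\<Sum>f\<in>RM m d. \<Sum>g\<in>RM m d. (\<Sum>p\<in>Pts m. chi {p} f * chi {p} g)\<^sup>2)
      = (\<Sum>f\<in>RM m d. \<Sum>g\<in>RM m d. \<Sum>p\<in>Pts m. \<Sum>q\<in>Pts m. (chi {p} f * chi {q} f) * (chi {p} g * chi {q} g))"
      by (simp add: power2_eq_square sum_product mult_ac del: chi_singleton)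
    also have "\<dots> = (\<Sum>p\<in>Pts m. \<Sum>q\<in>Pts m. \<Sum>f\<in>RM m d. \<Sum>g\<in>RM m d. (chi {p} f * chi {q} f) * (chi {p} g * chi {q} g))"
      by (simp only: sum.swap[of _ "Pts m" "RM m d"])
    also have "\<dots> = (\<Sum>p\<in>Pts m. \<Sum>q\<in>Pts m. (\<Sum>f\<in>RM m d. chi {p} f * chi {q} f) * (\<Sum>g\<in>RM m d. chi {p} g * chi {q} g))"
      by (simp add: sum_product del: chi_singleton)
    also have "\<dots> = (\<Sum>p\<in>Pts m. \<Sum>q\<in>Pts m. if p = q then n\<^sup>2 else 0)"
      by (intro sum.cong refl) (simp add: pq power2_eq_square del: chi_singleton)
    also have "\<dots> = 2 ^ m * n\<^sup>2" by (simp add: card_Pts)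
    finally show ?thesis using n by (simp add: power2_eq_square)
  qed
  have "(\<Sum>(f, g)\<in>?VV. 1 * \<bar>dictX m d f g\<bar>)\<^sup>2 \<le> (\<Sum>(f, g)\<in>?VV. 1\<^sup>2) * (\<Sum>(f, g)\<in>?VV. \<bar>dictX m d f g\<bar>\<^sup>2)"
    unfolding case_prod_beta by (rule Cauchy_Schwarz_ineq_sum)
  also have "\<dots> = n\<^sup>2 / 2 ^ m"
    using sq by (simp add: card_cartesian_product n_def power2_eq_square case_prod_beta)
  also have "\<dots> = (n / 2 powr (m / 2))\<^sup>2"
    by (simp add: power_divide powr_power powr_realpow)
  finally have "(\<Sum>(f, g)\<in>?VV. 1 * \<bar>dictX m d f g\<bar>) \<le> n / 2 powr (m / 2)"
    by (rule power2_le_imp_le) (use n in auto)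
  then show ?thesis by (simp add: n_def sum.cartesian_product[symmetric])
qed

lemma value_dictX:
  assumes d: "d \<le> m" and t: "t = 2 powr (real d - 1)"
  shows "mtrace (RM m d) (mmul (RM m d) (Amat m d t) (dictX m d)) \<ge> exp (-1)"
proof -
  define n where "n = real (card (RM m d))"
  have n: "n > 0" unfolding n_def using card_RM_pos by simp
  have "mtrace (RM m d) (mmul (RM m d) (Amat m d t) (dictX m d))
     = (\<Sum>f\<in>RM m d. \<Sum>g\<in>RM m d. \<Sum>p\<in>Pts m. (chi {p} f * Amat m d t f g) * chi {p} g) / (n * 2 ^ m)"
    unfolding mtrace_def mmul_def dictX_def n_def
    by (simp add: sum_divide_distrib sum_distrib_left mult_ac del: chi_singleton)
  also have "\<dots> = (\<Sum>p\<in>Pts m. \<Sum>f\<in>RM m d. \<Sum>g\<in>RM m d. (chi {p} f * Amat m d t f g) * chi {p} g) / (n * 2 ^ m)"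
    by (simp only: sum.swap[of _ _ "Pts m"])
  also have "\<dots> = (\<Sum>p\<in>Pts m. \<Sum>g\<in>RM m d. (\<Sum>f\<in>RM m d. chi {p} f * Amat m d t f g) * chi {p} g) / (n * 2 ^ m)"
    by (subst sum.swap) (simp add: sum_distrib_right del: chi_singleton)
  also have "\<dots> = (\<Sum>p\<in>Pts m. exp (eigM m d t {p}) * n) / (n * 2 ^ m)"
    by (intro arg_cong[where f="\<lambda>x. x / _"] sum.cong refl) (simp add: Amat_eigenvector mult.assoc n_def del: chi_singleton)
  also have "\<dots> = (\<Sum>p\<in>Pts m. exp (eigM m d t {p})) / 2 ^ m"
    using n by (simp add: sum_distrib_right[symmetric])
  finally have val: "mtrace (RM m d) (mmul (RM m d) (Amat m d t) (dictX m d)) = (\<Sum>p\<in>Pts m. exp (eigM m d t {p})) / 2 ^ m" .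
  \<comment> \<open>The tangent of exp at -1 reduces the claim to the average of the exponents,
    which is a double count of incidences between points and generators.\<close>
  have "exp (-1) * (2 + e) \<le> exp e" for e :: real
  proof -
    have "exp (-1) * (1 + (e + 1)) \<le> exp (-1) * exp (e + 1)"
      by (intro mult_left_mono exp_ge_add_one_self) auto
    then show ?thesis by (simp add: add.commute flip: exp_add)
  qed
  then have "(\<Sum>p\<in>Pts m. exp (-1) * (2 + eigM m d t {p})) \<le> (\<Sum>p\<in>Pts m. exp (eigM m d t {p}))"
    by (intro sum_mono)
  moreover have "(\<Sum>p\<in>Pts m. exp (-1) * (2 + eigM m d t {p})) = exp (-1) * 2 ^ m"
    using sum_eigM_singletons[OF d t]
    by (simp add: sum_distrib_left[symmetric] sum.distrib card_Pts)
  ultimately show ?thesis unfolding val by (simp add: pos_le_divide_eq)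
qed

section \<open>Sparse vectors\<close>

lemma rm_rej_le_eigM:
  assumes A: "A \<subseteq> Pts m" and d: "d < m" and t: "t \<ge> 0"
  shows "eigM m d t A \<le> - 2 * t * rm_rej m (m - d - 1) (\<lambda>x\<in>Pts m. x \<in> A)"
proof -
  have "{x\<in>A. h x} = {x\<in>Pts m. h x \<and> (\<lambda>x\<in>Pts m. x \<in> A) x}" for h using A by auto
  then have "eigM m d t A = - 2 * t * (card {h\<in>Tgen m d. odd (card {x\<in>Pts m. h x \<and> (\<lambda>x\<in>Pts m. x \<in> A) x})} / card (Tgen m d))"
    using eigM_eq[OF A, of d t] d by (simp only: less_imp_le)
  moreover have "2 * t * rm_rej m (m - d - 1) (\<lambda>x\<in>Pts m. x \<in> A) \<le> 2 * t *
      (card {h\<in>Tgen m d. odd (card {x\<in>Pts m. h x \<and> (\<lambda>x\<in>Pts m. x \<in> A) x})} / card (Tgen m d))"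
    using t by (intro mult_left_mono rm_rej_le[OF d]) auto
  ultimately show ?thesis by simp
qed

definition near :: "nat \<Rightarrow> nat \<Rightarrow> nat \<Rightarrow> nat set set set" where
  "near m e l = {A\<in>Pow (Pts m). \<exists>g\<in>RM m e. card {x\<in>Pts m. (x \<in> A) \<noteq> g x} \<le> l}"

text \<open>The relative distance exceeds l / 2^m. The testing theorem multiplies it by 2^(m-d-1)
  and the exponent by 2 t = 2^d, together l/2.\<close>

lemma eigM_far:
  assumes eps: "bkssz_const eps" and d: "d < m" and t: "t = 2 powr (real d - 1)"
    and A: "A \<subseteq> Pts m" "A \<notin> near m (m - d - 1) l"
  shows "eigM m d t A \<le> - min (real l / 2) (eps * 2 ^ d)"
proof -
  define f where "f = (\<lambda>x\<in>Pts m. x \<in> A)"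
  have t2: "2 * t = 2 ^ d" by (simp add: t powr_diff powr_realpow)
  then have t0: "t \<ge> 0" using t by simp
  have dist: "rm_dist m (m - d - 1) f \<ge> real l / 2 ^ m"
    unfolding rm_dist_def
  proof (subst Min_ge_iff)
    have "{x\<in>Pts m. f x \<noteq> g x} = {x\<in>Pts m. (x \<in> A) \<noteq> g x}" for g by (auto simp: f_def)
    then show "\<forall>a\<in>{real (card {x\<in>Pts m. f x \<noteq> g x}) / 2 ^ m | g. g \<in> RM m (m - d - 1)}. real l / 2 ^ m \<le> a"
      using A by (auto simp: near_def divide_right_mono)
    show "finite {real (card {x\<in>Pts m. f x \<noteq> g x}) / 2 ^ m | g. g \<in> RM m (m - d - 1)}" by simp
    show "{real (card {x\<in>Pts m. f x \<noteq> g x}) / 2 ^ m | g. g \<in> RM m (m - d - 1)} \<noteq> {}"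
      using RM_zero[of m "m - d - 1"] by blast
  qed
  have two: "(2::real) ^ d * 2 ^ (m - d - 1) = 2 ^ m / 2"
  proof -
    have "(2::real) ^ m = 2 ^ (d + (m - d - 1) + 1)" using d by simp
    then show ?thesis unfolding power_add by simp
  qed
  have "min (2 ^ (m - d - 1) * rm_dist m (m - d - 1) f) eps \<le> rm_rej m (m - d - 1) f"
    using eps unfolding bkssz_const_def f_def by auto
  moreover have "min (2 ^ (m - d - 1) * (real l / 2 ^ m)) eps \<le> min (2 ^ (m - d - 1) * rm_dist m (m - d - 1) f) eps"
    using dist by (intro min.mono mult_left_mono) auto
  ultimately have "min (2 ^ (m - d - 1) * (real l / 2 ^ m)) eps \<le> rm_rej m (m - d - 1) f"
    by (rule order_trans[rotated])
  then have "2 ^ d * min (2 ^ (m - d - 1) * (real l / 2 ^ m)) eps \<le> 2 ^ d * rm_rej m (m - d - 1) f"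
    by (rule mult_left_mono) simp
  moreover have "2 ^ d * min (2 ^ (m - d - 1) * (real l / 2 ^ m)) eps = min (real l / 2) (eps * 2 ^ d)"
  proof -
    have "2 ^ d * (2 ^ (m - d - 1) * (real l / 2 ^ m)) = real l / 2"
      unfolding mult.assoc[symmetric] two by simp
    moreover have "2 ^ d * min u v = min (2 ^ d * u) (2 ^ d * v)" for u v :: real
      by (simp add: min_def)
    ultimately show ?thesis by (simp only: mult.commute[of eps])
  qed
  ultimately have "min (real l / 2) (eps * 2 ^ d) \<le> 2 * t * rm_rej m (m - d - 1) f"
    unfolding t2 by (simp only:)
  then show ?thesis using rm_rej_le_eigM[OF A(1) d t0] unfolding f_def by simp
qed

text \<open>Shifting A by an element of the dual code does not change its character on the code, and the
  overcount card (RM m (m - d - 1)) is compensated by the frame constant.\<close>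

lemma sum_near_le:
  assumes d: "d < m"
  shows "(\<Sum>A\<in>near m (m - d - 1) l. (\<Sum>f\<in>RM m d. x f * chi A f)\<^sup>2)
    \<le> 2 ^ 2 ^ m / card (RM m d) * (\<Sum>B | B \<subseteq> Pts m \<and> card B \<le> l. (\<Sum>f\<in>RM m d. x f * chi B f)\<^sup>2)"
proof -
  define c where "c = (\<lambda>A. (\<Sum>f\<in>RM m d. x f * chi A f)\<^sup>2)"
  define W where "W = {B. B \<subseteq> Pts m \<and> card B \<le> l}"
  define R where "R = RM m (m - d - 1)"
  define J where "J = (\<lambda>(g, B). sym_diff {y\<in>Pts m. g y} B)"
  have finW: "finite W" unfolding W_def by (rule finite_subset[of _ "Pow (Pts m)"]) auto
  have finR: "finite (R \<times> W)" using finW by (simp add: R_def)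
  have cJ: "c (J q) = c (snd q)" if qRW: "q \<in> R \<times> W" for q
  proof -
    obtain g B where q: "q = (g, B)" "g \<in> R" "B \<subseteq> Pts m" using qRW by (auto simp: W_def)
    have "chi (J q) f = chi B f" if "f \<in> RM m d" for f
    proof -
      have "chi {y\<in>Pts m. g y} f = 1" using that q d by (intro RM_orthogonal[of f m d g "m - d - 1"]) (auto simp: R_def)
      then show ?thesis using q finite_subset[OF q(3)] by (simp add: J_def chi_sym_diff)
    qed
    then show ?thesis by (simp add: c_def q)
  qed
  have sub: "near m (m - d - 1) l \<subseteq> J ` (R \<times> W)"
  proof
    fix A assume "A \<in> near m (m - d - 1) l"
    then obtain g where g: "A \<subseteq> Pts m" "g \<in> R" "card {y\<in>Pts m. (y \<in> A) \<noteq> g y} \<le> l"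
      by (auto simp: near_def R_def)
    show "A \<in> J ` (R \<times> W)"
    proof (rule image_eqI[of _ _ "(g, {y\<in>Pts m. (y \<in> A) \<noteq> g y})"])
      show "A = J (g, {y\<in>Pts m. (y \<in> A) \<noteq> g y})" using g(1) by (auto simp: J_def)
    qed (use g in \<open>auto simp: W_def\<close>)
  qed
  have "sum c (near m (m - d - 1) l) \<le> sum c (J ` (R \<times> W))"
    using finR sub by (intro sum_mono2) (auto simp: c_def)
  \<comment> \<open>J may reach a set several times; nonnegative terms make this harmless for an
    upper bound.\<close>
  also have "\<dots> \<le> sum (c \<circ> J) (R \<times> W)"
    using finR by (intro sum_image_le) (auto simp: c_def)
  also have "\<dots> = (\<Sum>q\<in>R \<times> W. c (snd q))" using cJ by simp
  also have "\<dots> = card R * sum c W" by (simp add: sum.cartesian_product' )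
  also have "\<dots> \<le> 2 ^ 2 ^ m / card (RM m d) * sum c W"
  proof (rule mult_right_mono)
    have "real (card (RM m d) * card R) \<le> real (2 ^ 2 ^ m)"
      using card_RM_dual_le[OF d] unfolding R_def of_nat_le_iff .
    then show "real (card R) \<le> 2 ^ 2 ^ m / card (RM m d)"
      using card_RM_pos[of m d] by (simp add: pos_le_divide_eq mult.commute)
  qed (auto simp: c_def intro: sum_nonneg)
  finally show ?thesis unfolding c_def W_def .
qed

text \<open>Near the dual code the eigenvalue is bounded by 1 and the weight is small; elsewhere the
  weight is bounded by \<open>parseval\<close> and the eigenvalue is small. The condition on l keeps
  fourfold products below the dual distance.\<close>

lemma sparse_value_bound:
  assumes eps: "bkssz_const eps" and d: "d < m" and t: "t = 2 powr (real d - 1)"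
    and l: "4 * l < 2 ^ Suc d"
    and unit: "(\<Sum>f\<in>RM m d. (x f)\<^sup>2) = 1"
    and sparse: "real (card {f\<in>RM m d. x f \<noteq> 0}) \<le> real (card (RM m d)) / 2 powr (real m / 2)"
  shows "(\<Sum>f\<in>RM m d. \<Sum>g\<in>RM m d. x f * Amat m d t f g * x g)
    \<le> 3 ^ l / 2 powr (real m / 4) + exp (- min (real l / 2) (eps * 2 ^ d))"
proof -
  define n where "n = real (card (RM m d))"
  define N where "N = (2::real) ^ 2 ^ m"
  define c where "c = (\<lambda>A. (\<Sum>f\<in>RM m d. x f * chi A f)\<^sup>2)"
  define L where "L = (\<Sum>B | B \<subseteq> Pts m \<and> card B \<le> l. c B)"
  define E where "E = exp (- min (real l / 2) (eps * 2 ^ d))"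
  let ?near = "near m (m - d - 1) l"
  have pos: "n > 0" "N > 0" "E > 0" "\<And>A. c A \<ge> 0"
    using card_RM_pos by (auto simp: n_def N_def E_def c_def)
  have t0: "t \<ge> 0" by (simp add: t)
  have "L\<^sup>2 \<le> card {f\<in>RM m d. x f \<noteq> 0} * n * 9 ^ l"
    unfolding L_def c_def n_def using l
    by (intro low_level_weight unit sum_RM_chi_zero) auto
  also have "\<dots> \<le> n / 2 powr (m / 2) * n * 9 ^ l"
    using sparse pos unfolding n_def by (intro mult_right_mono) auto
  also have "\<dots> = (n * (3 ^ l / 2 powr (m / 4)))\<^sup>2"
  proof -
    have "(2 powr (real m / 4))\<^sup>2 = 2 powr (m / 2)" by (simp add: powr_power)
    moreover have "((3::real) ^ l)\<^sup>2 = 9 ^ l" by (simp add: power2_eq_square flip: power_mult_distrib)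
    ultimately show ?thesis by (simp add: power_mult_distrib power_divide) (simp add: power2_eq_square)
  qed
  finally have "L \<le> n * (3 ^ l / 2 powr (m / 4))"
    by (rule power2_le_imp_le) (use pos in auto)
  then have Ln: "L / n \<le> 3 ^ l / 2 powr (m / 4)" using pos by (simp add: pos_divide_le_eq mult.commute)
  have low: "exp (eigM m d t A) * c A \<le> c A" if "A \<in> Pow (Pts m)" for A
  proof -
    have "eigM m d t A \<le> 0" using that eigM_eq[of A m d t] d t0 by simp
    then show ?thesis using pos(4)[of A] by (simp add: mult_left_le_one_le)
  qed
  have high: "exp (eigM m d t A) * c A \<le> E * c A" if "A \<in> Pow (Pts m) - ?near" for A
    unfolding E_def using that eigM_far[OF eps d t] pos(4)[of A] by (intro mult_right_mono) auto
  have sub: "?near \<subseteq> Pow (Pts m)" by (auto simp: near_def)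
  have "(\<Sum>A\<in>Pow (Pts m). exp (eigM m d t A) * c A)
     = (\<Sum>A\<in>?near. exp (eigM m d t A) * c A) + (\<Sum>A\<in>Pow (Pts m) - ?near. exp (eigM m d t A) * c A)"
    using sub by (subst sum.subset_diff[of ?near]) auto
  also have "\<dots> \<le> sum c ?near + (\<Sum>A\<in>Pow (Pts m) - ?near. E * c A)"
    using low high sub by (intro add_mono sum_mono) auto
  also have "(\<Sum>A\<in>Pow (Pts m) - ?near. E * c A) \<le> (\<Sum>A\<in>Pow (Pts m). E * c A)"
    using pos by (intro sum_mono2) auto
  also have "\<dots> = E * N" using parseval[where m=m and d=d and x=x] unit by (simp add: sum_distrib_left[symmetric] c_def N_def)
  also have "sum c ?near \<le> N / n * L"
    using sum_near_le[OF d] unfolding c_def N_def n_def L_def .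
  finally have "(\<Sum>A\<in>Pow (Pts m). exp (eigM m d t A) * c A) / N \<le> (N / n * L + E * N) / N"
    using pos by (intro divide_right_mono) auto
  also have "\<dots> = L / n + E" using pos by (simp add: field_simps)
  finally show ?thesis
    unfolding Amat_quadratic_form using Ln by (simp add: c_def N_def E_def)
qed

section \<open>Parameters\<close>

text \<open>log_2 (1/eta) = (m/2) / (4 log_2 3), and the -1 in d doubles the denominator to
  16.\<close>

lemma two_power_dpar:
  assumes m: "m \<ge> 1" and a: "eps2 eps1 > 0" and d: "real d = dpar eps1 m"
  shows "2 ^ d = real m / (16 * log 2 3 * eps2 eps1)"
proof -
  have l3: "log 2 3 > (0::real)" by simp
  have "etap m = 2 powr (- (real m / 2 * (1 / (4 * log 2 3))))"
    unfolding etap_def deltap_def powr_powr by simp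
  then have "1 / etap m = 2 powr (real m / 2 * (1 / (4 * log 2 3)))"
    by (simp only: powr_minus_divide) simp
  then have "log 2 (1 / etap m) = real m / (8 * log 2 3)" by simp
  then have "real d = log 2 (real m / (8 * log 2 3)) + log 2 (1 / eps2 eps1) - 1"
    using d by (simp add: dpar_def)
  then have "2 powr real d = 2 powr (log 2 (real m / (8 * log 2 3))) * 2 powr (log 2 (1 / eps2 eps1)) / 2 powr 1"
    by (simp only: powr_add powr_diff)
  also have "\<dots> = real m / (8 * log 2 3) * (1 / eps2 eps1) / 2"
    using m a l3 by (subst (1 2) powr_log_cancel) auto
  finally show ?thesis by (simp add: powr_realpow)
qed

lemma square_less_two_power: "m \<ge> 5 \<Longrightarrow> m\<^sup>2 < (2::nat) ^ m"
proof (induction m rule: nat_induct_at_least)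
  case (Suc m)
  have "5 * m \<le> m\<^sup>2" using Suc by (simp add: power2_eq_square)
  moreover have "(Suc m)\<^sup>2 = m\<^sup>2 + 2 * m + 1" by (simp add: power2_eq_square)
  ultimately show ?case using Suc unfolding power_Suc by linarith
qed simp

text \<open>There are at most (m+1)^d monomials, so ln (ln n) is at most d ln (m+1), and d itself is
  O(ln m).\<close>

lemma ln_ln_card_RM_le:
  assumes m: "m \<ge> 1" and d: "2 ^ d \<le> (real m)\<^sup>2"
  shows "sqrt (ln (ln (real (card (RM m d))))) \<le> 2 * ln (real m + 1)"
proof (cases "ln (real (card (RM m d))) > 0")
  \<comment> \<open>Here ln n = 0, and the convention ln 0 = 0 makes the left side 0.\<close>
  case False
  moreover have "ln (real (card (RM m d))) \<ge> 0" using card_RM_pos[of m d] by simp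
  ultimately show ?thesis by simp
next
  case True
  have "card (RM m d) \<le> (2::nat) ^ (m + 1) ^ d"
    by (rule order_trans[OF card_RM_le]) (intro power_increasing card_monoms_le, simp)
  then have "real (card (RM m d)) \<le> 2 ^ (m + 1) ^ d"
    by (metis of_nat_le_iff of_nat_numeral of_nat_power)
  then have "ln (real (card (RM m d))) \<le> ln (2 ^ (m + 1) ^ d)"
    using card_RM_pos[of m d] by (subst ln_le_cancel_iff) auto
  also have "\<dots> = real ((m + 1) ^ d) * ln 2" by (simp add: ln_realpow)
  also have "\<dots> \<le> real ((m + 1) ^ d) * 1" using ln_2_less_1 by (intro mult_left_mono) auto
  finally have "ln (real (card (RM m d))) \<le> (real m + 1) ^ d" by (simp add: add.commute)
  then have "ln (ln (real (card (RM m d)))) \<le> ln ((real m + 1) ^ d)"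
    using True by (subst ln_le_cancel_iff) auto
  also have "\<dots> = real d * ln (real m + 1)" by (simp add: ln_realpow)
  also have "\<dots> \<le> (4 * ln (real m + 1)) * ln (real m + 1)"
  proof (rule mult_right_mono)
    have "real d * ln 2 = ln (2 ^ d)" by (simp add: ln_realpow)
    also have "\<dots> \<le> ln ((real m)\<^sup>2)" using d m by (subst ln_le_cancel_iff) auto
    also have "\<dots> = 2 * ln (real m)" using m by (simp add: ln_realpow)
    also have "\<dots> \<le> 2 * ln (real m + 1)" using m by simp
    finally have "real d * ln 2 \<le> 2 * ln (real m + 1)" .
    moreover have "real d * (1 / 2) \<le> real d * ln 2"
      using ln2_ge_two_thirds by (intro mult_left_mono) auto
    ultimately show "real d \<le> 4 * ln (real m + 1)" by linarith
  qed simp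
  also have "\<dots> = (2 * ln (real m + 1))\<^sup>2" by (simp add: power2_eq_square)
  finally show ?thesis by (intro real_le_lsqrt) auto
qed

text \<open>Quantifying over d with \<open>real d = dpar eps1 m\<close> encodes the assumed
  integrality, and one constant c serves both asymptotic claims.\<close>

theorem theorem5:
  fixes eps1 :: real
  assumes "bkssz_const eps1"
  shows "\<exists>c>0. \<exists>M. \<forall>m d. m \<ge> M \<longrightarrow> real d = dpar eps1 m \<longrightarrow>
     (let V = RM m d; n = card V; k = real n / 2 powr (real m / 2);
          t = 2 powr (real d - 1); A = Amat m d t in
       (\<exists>X. psd V X \<and> mtrace V X = 1 \<and> (\<Sum>f\<in>V. \<Sum>g\<in>V. \<bar>X f g\<bar>) \<le> k \<and>
            mtrace V (mmul V A X) \<ge> c) \<and>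
       (\<forall>x. (\<Sum>f\<in>V. (x f)\<^sup>2) = 1 \<longrightarrow> real (card {f\<in>V. x f \<noteq> 0}) \<le> k \<longrightarrow>
            (\<Sum>f\<in>V. \<Sum>g\<in>V. x f * A f g * x g)
              \<le> 1 / exp (exp (c * sqrt (ln (ln (real n)))))))"
proof -
  define a where "a = eps2 eps1"
  have a: "a > 0" "a \<le> eps1" "a \<le> 1 / 20"
    using assms by (auto simp: a_def eps2_def bkssz_const_def)
  have l3: "1 \<le> log 2 (3::real)" "log 2 (3::real) \<le> 2"
    by (simp_all add: le_log_iff log_le_iff)
  \<comment> \<open>The bound 5000 exceeds 64^2, as the final estimate sqrt (m+1) <= m/64 requires;
    1/a ensures 2^d <= m^2.\<close>
  define M where "M = max 5000 (nat \<lceil>1 / a\<rceil>)"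
  show ?thesis
  \<comment> \<open>1/4 lies below exp (-1), and 1/4 times 2 ln (m+1) is ln (sqrt (m+1)).\<close>
  proof (intro exI[of _ "1/4::real"] conjI exI[of _ M] allI impI, simp)
    fix m d :: nat
    assume mM: "M \<le> m" and d: "real d = dpar eps1 m"
    have m: "m \<ge> 5000" using mM by (simp add: M_def)
    have "1 / a \<le> real m" using mM unfolding M_def by linarith
    have pd: "2 ^ d = real m / (16 * log 2 3 * a)"
      using two_power_dpar[OF _ _ d] m a unfolding a_def by simp
    have pd_upper: "2 ^ d \<le> (real m)\<^sup>2"
    proof -
      have "2 ^ d \<le> real m / (1 * a)"
      proof -
        have "1 \<le> 16 * log 2 (3::real)" using l3 by linarith
        then show ?thesis unfolding pd using a by (intro divide_left_mono mult_right_mono) auto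
      qed
      also have "\<dots> = real m * (1 / a)" by simp
      also have "\<dots> \<le> real m * real m" using \<open>1 / a \<le> real m\<close> by (intro mult_left_mono) auto
      finally show ?thesis by (simp add: power2_eq_square)
    qed
    have pd_eps: "real m / 32 \<le> eps1 * 2 ^ d"
    proof -
      have "real m / 32 \<le> real m / (16 * log 2 3)" using l3 by (intro divide_left_mono) auto
      also have "\<dots> = a * 2 ^ d" unfolding pd using a by simp
      also have "\<dots> \<le> eps1 * 2 ^ d" using a by (intro mult_right_mono) auto
      finally show ?thesis .
    qed
    \<comment> \<open>The cap 1/20 enters here: 16 * 2 / 20 = 1.6 is below 2.\<close>
    have pd_lower: "real m \<le> 2 ^ Suc d"
    proof -
      have "log 2 3 * a \<le> 2 * (1 / 20)" using l3 a by (intro mult_mono) auto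
      then have "real m / (16 * (2 * (1 / 20))) \<le> real m / (16 * (log 2 3 * a))"
        using l3 a by (intro divide_left_mono mult_left_mono mult_pos_pos) auto
      then show ?thesis unfolding power_Suc pd by (simp add: mult.assoc)
    qed
    have dm: "d < m"
    proof (rule ccontr)
      assume "\<not> d < m"
      then have "real (2 ^ m) \<le> 2 ^ d" by (simp add: power_increasing)
      also have "\<dots> \<le> real (m\<^sup>2)" using pd_upper by simp
      finally have "2 ^ m \<le> m\<^sup>2" by (simp only: of_nat_le_iff)
      then show False using square_less_two_power[of m] m by simp
    qed
    have d1: "d \<ge> 1"
    proof (rule ccontr)
      assume "\<not> d \<ge> 1"
      then have "d = 0" by simp
      then show False using pd_lower m by simp
    qed
    define t where "t = 2 powr (real d - 1)"
    define n where "n = card (RM m d)"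
    have "(1::real) / 4 \<le> exp (-1)" using exp_le by (simp add: exp_minus field_simps)
    then have "mtrace (RM m d) (mmul (RM m d) (Amat m d t) (dictX m d)) \<ge> 1 / 4"
      using value_dictX[OF _ t_def] dm by (meson less_imp_le order_trans)
    then have sdp: "\<exists>X. psd (RM m d) X \<and> mtrace (RM m d) X = 1 \<and>
        (\<Sum>f\<in>RM m d. \<Sum>g\<in>RM m d. \<bar>X f g\<bar>) \<le> real n / 2 powr (real m / 2) \<and>
        mtrace (RM m d) (mmul (RM m d) (Amat m d t) X) \<ge> 1 / 4"
      using psd_dictX trace_dictX sum_abs_dictX[OF d1] unfolding n_def by blast
    have "(\<Sum>f\<in>RM m d. \<Sum>g\<in>RM m d. x f * Amat m d t f g * x g)
        \<le> 1 / exp (exp (1 / 4 * sqrt (ln (ln (real n)))))"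
      if x: "(\<Sum>f\<in>RM m d. (x f)\<^sup>2) = 1"
        "real (card {f\<in>RM m d. x f \<noteq> 0}) \<le> real n / 2 powr (real m / 2)" for x
    proof -
      \<comment> \<open>Rounding down costs less than 1 in l, hence the 1/2 in the exponents
        below.\<close>
      define l where "l = m div 16"
      have l: "real l \<le> real m / 16" "real l \<ge> real m / 16 - 1"
        unfolding l_def by linarith+
      have "4 * real l < 2 ^ Suc d" using l pd_lower m by linarith
      then have "real (4 * l) < real (2 ^ Suc d)" by simp
      then have l4: "4 * l < 2 ^ Suc d" by (simp only: of_nat_less_iff)
      have "(3::real) ^ l \<le> 4 ^ l" by (intro power_mono) auto
      also have "\<dots> = 2 powr (2 * real l)" by (simp add: powr_powr[symmetric] powr_realpow)
      also have "\<dots> \<le> 2 powr (real m / 8)" using l by (intro powr_mono) auto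
      finally have "3 ^ l / 2 powr (real m / 4) \<le> 2 powr (real m / 8) / 2 powr (real m / 4)"
        by (intro divide_right_mono) auto
      also have "\<dots> = exp (- (real m / 8) * ln 2)"
        by (simp add: powr_def flip: exp_diff)
      also have "\<dots> \<le> exp (1 / 2 - real m / 32)"
      proof -
        have "real m / 8 * (1 / 2) \<le> real m / 8 * ln 2"
          using ln2_ge_two_thirds by (intro mult_left_mono) auto
        then show ?thesis by simp
      qed
      finally have low: "3 ^ l / 2 powr (real m / 4) \<le> exp (1 / 2 - real m / 32)" .
      have "min (real l / 2) (eps1 * 2 ^ d) \<ge> real m / 32 - 1 / 2"
        using l pd_eps by (simp add: min_def)
      then have high: "exp (- min (real l / 2) (eps1 * 2 ^ d)) \<le> exp (1 / 2 - real m / 32)"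
        unfolding exp_le_cancel_iff by linarith
      have "(\<Sum>f\<in>RM m d. \<Sum>g\<in>RM m d. x f * Amat m d t f g * x g) \<le> 2 * exp (1 / 2 - real m / 32)"
        using sparse_value_bound[OF assms dm t_def l4 x(1) x(2)[unfolded n_def]] low high by linarith
      also have "\<dots> \<le> exp 1 * exp (1 / 2 - real m / 32)"
        using exp_ge_add_one_self[of 1] by (intro mult_right_mono) auto
      also have "\<dots> = exp (3 / 2 - real m / 32)" by (simp flip: exp_add)
      \<comment> \<open>Half of the exponent is given up to absorb the constant 3/2.\<close>
      also have "\<dots> \<le> exp (- (real m / 64))" using m by simp
      also have "\<dots> \<le> exp (- exp (1 / 4 * sqrt (ln (ln (real n)))))"
      proof -
        have "1 / 4 * sqrt (ln (ln (real n))) \<le> 1 / 2 * ln (real m + 1)"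
          using ln_ln_card_RM_le[OF _ pd_upper] m unfolding n_def by simp
        then have "exp (1 / 4 * sqrt (ln (ln (real n)))) \<le> exp (1 / 2 * ln (real m + 1))" by simp
        also have "\<dots> = sqrt (real m + 1)" by (simp add: powr_half_sqrt[symmetric] powr_def)
        also have "\<dots> \<le> real m / 64"
        proof (rule real_le_lsqrt)
          have "5000 * real m \<le> real m * real m" using m by (intro mult_right_mono) auto
          moreover have "(real m / 64)\<^sup>2 = real m * real m / 4096" by (simp add: power2_eq_square)
          ultimately show "real m + 1 \<le> (real m / 64)\<^sup>2" using m by linarith
        qed auto
        finally show ?thesis by simp
      qed
      finally show ?thesis unfolding exp_minus inverse_eq_divide .
    qed
    with sdp show "let V = RM m d; n = card V; k = real n / 2 powr (real m / 2);
          t = 2 powr (real d - 1); A = Amat m d t in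
       (\<exists>X. psd V X \<and> mtrace V X = 1 \<and> (\<Sum>f\<in>V. \<Sum>g\<in>V. \<bar>X f g\<bar>) \<le> k \<and>
            mtrace V (mmul V A X) \<ge> 1 / 4) \<and>
       (\<forall>x. (\<Sum>f\<in>V. (x f)\<^sup>2) = 1 \<longrightarrow> real (card {f\<in>V. x f \<noteq> 0}) \<le> k \<longrightarrow>
            (\<Sum>f\<in>V. \<Sum>g\<in>V. x f * A f g * x g)
              \<le> 1 / exp (exp (1 / 4 * sqrt (ln (ln (real n))))))"
      unfolding Let_def t_def n_def by blast
  qed
qed

end
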